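(* Let $\rho \ge 0$ and set $$L_\rho = \frac{\lambda_{\max}(W)}{\mu + \rho \lambda_{\max}(W)},\qquad \mu_\rho = \frac{\lambda_{\min}^+(W)}{L + \rho \lambda_{\min}^+(W)}.$$ Let $(\mathbf{X}_k)_{k\ge 1}$ be any sequence of primal variables generated by the inexact accelerated decentralized augmented Lagrangian method (IDEAL, described in the context) in which, for every $k\ge1$, the subproblem $P_k$ is solved to accuracy $\epsilon_k$, i.e. $\|\mathbf{X}_k-\mathbf{X}_k^*\|^2\le \epsilon_k$, with parameters $$\beta_k = \frac{\sqrt{L_\rho} - \sqrt{\mu_\rho}}{\sqrt{L_\rho}+\sqrt{\mu_\rho}},\qquad \eta = \frac{1}{L_\rho},\qquad \epsilon_k = \frac{\mu_\rho}{2 \lambda_{\max}(W)} \left(1-\frac{1}{2}\sqrt{\frac{\mu_\rho}{L_\rho}}\right)^k \Delta_{dual}.$$ Then, for every $k\ge 1$, $$\|\mathbf{X}_k-\mathbf{X}^*\|^2 \le C_\rho \left(1-\frac12\sqrt{\frac{\mu_\rho}{L_\rho}}\right)^k \Delta_{dual},$$ where $\mathbf{X}^*=\mathbf{1}_n\otimes x^*$ and $C_\rho = 258\,\dfrac{L_\rho\lambda_{\max}(W)}{\mu^2\mu_\rho^2}$.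
   Context: Setting. $\mathcal G=(\mathcal V,\mathcal E)$ is a graph on $\mathcal V=\{1,\dots,n\}$. The functions $f_i:\mathbb{R}^d\to\mathbb{R}$, $i=1,\dots,n$, are differentiable, $L$-smooth ($\nabla f_i$ is $L$-Lipschitz) and $\mu$-strongly convex ($f_i-\frac{\mu}{2}\|x\|^2$ is convex), with $0<\mu\le L$. $x^*$ is the unique minimizer of $f(x)=\sum_{i=1}^n f_i(x)$ over $\mathbb{R}^d$. Mixing matrix. $W\in\mathbb{R}^{n\times n}$ is symmetric, positive semidefinite, satisfies $W_{ij}=W_{ji}=0$ whenever $i\ne j$ and $(i,j)\notin\mathcal E$, and has kernel $\mathbb{R}\mathbf 1_n$, where $\mathbf 1_n$ is the all-ones vector. $\lambda_{\max}(W)$ is its largest eigenvalue and $\lambda_{\min}^+(W)$ its smallest positive eigenvalue. Notation. For $\mathbf{X}=[x_1;\dots;x_n]\in\mathbb{R}^{nd}$ put $F(\mathbf{X})=\sum_{i=1}^n f_i(x_i)$. $\mathbf W=W\otimes I_d\in\mathbb{R}^{nd\times nd}$, $\sqrt{\mathbf W}$ is its positive semidefinite square root, and $\|\mathbf{X}\|_{\mathbf W}^2=\mathbf{X}^T\mathbf W\mathbf{X}$. $F^*$ is the convex conjugate of $F$. The dual problem is $\max_{\mathbf\Lambda\in\mathbb{R}^{nd}} -F^*(-\sqrt{\mathbf W}\mathbf\Lambda)$. The initial dual function gap is $\Delta_{dual}=F^*(0)-\min_{\mathbf\Lambda}F^*(-\sqrt{\mathbf W}\mathbf\Lambda)$ (the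 initial dual variable being $0$). Algorithm (IDEAL). Inputs: $W$, regularization parameter $\rho$, stepsize $\eta$, extrapolation parameters $\{\beta_k\}$, accuracies $\{\epsilon_k\}$. Initialize $\mathbf\Lambda_1=\mathbf\Omega_1=0\in\mathbb{R}^{nd}$. For $k=1,2,\dots$: let $P_k(\mathbf{X})=F(\mathbf{X})+\mathbf\Omega_k^T\mathbf{X}+\frac{\rho}{2}\|\mathbf{X}\|_{\mathbf W}^2$ and let $\mathbf{X}_k^*$ be its unique minimizer; compute (by any first-order method, warm-started at $\mathbf{X}_{k-1}$) a point $\mathbf{X}_k$ with $\|\mathbf{X}_k-\mathbf{X}_k^*\|^2\le\epsilon_k$; set $\mathbf\Lambda_{k+1}=\mathbf\Omega_k+\eta\mathbf W\mathbf{X}_k$ and $\mathbf\Omega_{k+1}=\mathbf\Lambda_{k+1}+\beta_{k+1}(\mathbf\Lambda_{k+1}-\mathbf\Lambda_k)$. *)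

theory Defs
  imports "HOL-Analysis.Analysis"
begin

definition L_smooth :: "real \<Rightarrow> ('a::real_inner \<Rightarrow> real) \<Rightarrow> bool" where
  "L_smooth L f \<longleftrightarrow> (\<exists>g. (\<forall>x. GDERIV f x :> g x) \<and> L-lipschitz_on UNIV g)"

definition strongly_convex :: "real \<Rightarrow> ('a::real_inner \<Rightarrow> real) \<Rightarrow> bool" where
  "strongly_convex \<mu> f \<longleftrightarrow> convex_on UNIV (\<lambda>x. f x - \<mu> / 2 * (norm x)\<^sup>2)"

(* Real-valued: only meaningful where the supremum is finite, which holds at every point
   when f is differentiable and strongly convex. *)
definition convex_conjugate :: "('a::real_inner \<Rightarrow> real) \<Rightarrow> 'a \<Rightarrow> real" where
  "convex_conjugate f y = (SUP x. y \<bullet> x - f x)"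

definition eigenvalues :: "real^'n^'n \<Rightarrow> real set" where
  "eigenvalues W = {l. \<exists>v. v \<noteq> 0 \<and> W *v v = l *\<^sub>R v}"

definition lambda_max :: "real^'n^'n \<Rightarrow> real" where
  "lambda_max W = Max (eigenvalues W)"

(* Unspecified when W has no positive eigenvalue, which for a mixing matrix happens only on a
   single node (W = 0). *)
definition lambda_min_pos :: "real^'n^'n \<Rightarrow> real" where
  "lambda_min_pos W = Min {l \<in> eigenvalues W. 0 < l}"

(* In \<open>1 :: real^'n\<close> every component is 1. *)
definition mixing_matrix :: "('n \<times> 'n) set \<Rightarrow> real^'n^'n \<Rightarrow> bool" where
  "mixing_matrix E W \<longleftrightarrow>
     transpose W = W \<and>
     (\<forall>v. 0 \<le> v \<bullet> (W *v v)) \<and>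
     (\<forall>i j. i \<noteq> j \<and> (i, j) \<notin> E \<longrightarrow> W $ i $ j = 0 \<and> W $ j $ i = 0) \<and>
     {v. W *v v = 0} = span {1}"

(* The space of stacked vectors [x_1; ...; x_n] is (real^'d)^'n, whose inner product and norm
   are the Euclidean ones of R^(nd). The Kronecker product of W with the identity matrix of
   size d is the operator whose (i,j) block is W_ij times the identity. *)
definition kron_id :: "real^'n^'n \<Rightarrow> (real^'d)^'n \<Rightarrow> (real^'d)^'n" where
  "kron_id W X = (\<chi> i. \<Sum>j\<in>UNIV. W $ i $ j *\<^sub>R X $ j)"

definition psd_op :: "('a::real_inner \<Rightarrow> 'a) \<Rightarrow> bool" where
  "psd_op S \<longleftrightarrow> linear S \<and> (\<forall>x y. S x \<bullet> y = x \<bullet> S y) \<and> (\<forall>x. 0 \<le> x \<bullet> S x)"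

definition psd_sqrt :: "('a::real_inner \<Rightarrow> 'a) \<Rightarrow> 'a \<Rightarrow> 'a" where
  "psd_sqrt A = (THE S. psd_op S \<and> S \<circ> S = A)"

definition sum_fun :: "('n::finite \<Rightarrow> real^'d \<Rightarrow> real) \<Rightarrow> (real^'d)^'n \<Rightarrow> real" where
  "sum_fun f X = (\<Sum>i\<in>UNIV. f i (X $ i))"

(* LEAST picks the minimum over the dual variable, provided it is attained; for the strongly
   convex, smooth functions considered here it is. *)
definition dual_gap :: "real^'n^'n \<Rightarrow> ('n \<Rightarrow> real^'d \<Rightarrow> real) \<Rightarrow> real" where
  "dual_gap W f = convex_conjugate (sum_fun f) 0 -
     (LEAST v. v \<in> range (\<lambda>\<Lambda>. convex_conjugate (sum_fun f) (- psd_sqrt (kron_id W) \<Lambda>)))"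

definition subproblem ::
  "real^'n^'n \<Rightarrow> ('n \<Rightarrow> real^'d \<Rightarrow> real) \<Rightarrow> real \<Rightarrow> (real^'d)^'n \<Rightarrow> (real^'d)^'n \<Rightarrow> real" where
  "subproblem W f \<rho> \<Omega> X = sum_fun f X + \<Omega> \<bullet> X + \<rho> / 2 * (X \<bullet> kron_id W X)"

(* The sequences start at index 1; their values at 0 are unconstrained. The inner solver enters
   only through the accuracy of its output. *)
definition IDEAL_iterates ::
  "real^'n^'n \<Rightarrow> ('n \<Rightarrow> real^'d \<Rightarrow> real) \<Rightarrow> real \<Rightarrow> real \<Rightarrow> (nat \<Rightarrow> real) \<Rightarrow> (nat \<Rightarrow> real) \<Rightarrow>
   (nat \<Rightarrow> (real^'d)^'n) \<Rightarrow> (nat \<Rightarrow> (real^'d)^'n) \<Rightarrow> (nat \<Rightarrow> (real^'d)^'n) \<Rightarrow> bool" where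
  "IDEAL_iterates W f \<rho> \<eta> \<beta> \<epsilon> \<Lambda> \<Omega> X \<longleftrightarrow>
     \<Lambda> 1 = 0 \<and> \<Omega> 1 = 0 \<and>
     (\<forall>k\<ge>1.
        (norm (X k - (ARG_MIN (subproblem W f \<rho> (\<Omega> k)) Y. True)))\<^sup>2 \<le> \<epsilon> k \<and>
        \<Lambda> (k + 1) = \<Omega> k + \<eta> *\<^sub>R kron_id W (X k) \<and>
        \<Omega> (k + 1) = \<Lambda> (k + 1) + \<beta> (k + 1) *\<^sub>R (\<Lambda> (k + 1) - \<Lambda> k))"

end

theory Submission
  imports Defs
begin

text \<open>
  The method is Nesterov's accelerated gradient descent, with inexact gradients, applied to the
  dual problem. Let \<open>A = W \<otimes> I\<close>, let \<open>S\<close> be its positive semidefinite square root and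
  \<open>F\<^sub>\<rho>(X) = F(X) + \<rho>/2 \<parallel>S X\<parallel>\<^sup>2\<close>. Consensus is the constraint \<open>S X = 0\<close>, and its dual function is
  \<open>G(a) = - min\<^sub>X (F\<^sub>\<rho>(X) + a \<bullet> S X)\<close>, with gradient \<open>- S (M a)\<close> where \<open>M a\<close> attains the minimum.
  Writing \<open>\<Lambda>\<^sub>k = S u\<^sub>k\<close> and \<open>\<Omega>\<^sub>k = S y\<^sub>k\<close>, the iteration becomes the accelerated method for \<open>G\<close> with
  iterates \<open>u\<^sub>k\<close>, \<open>y\<^sub>k\<close> and gradient error \<open>- S (X\<^sub>k - M y\<^sub>k)\<close>, which the accuracy \<open>\<epsilon>\<^sub>k\<close> controls.

  Three facts make this work. Comparing the minimum that defines \<open>G\<close> with well chosen test points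
  shows that \<open>G\<close> is \<open>L\<^sub>\<rho>\<close>-smooth and, along the range of \<open>S\<close>, \<open>\<mu>\<^sub>\<rho>\<close>-strongly convex
  (\<open>dual_upper\<close>, \<open>dual_lower\<close>); all iterates stay in that range. The accelerated method has a
  potential that contracts by \<open>1 - \<alpha>\<close> per step, where \<open>\<alpha> = sqrt (\<mu>\<^sub>\<rho> / L\<^sub>\<rho>)\<close>, up to an error term
  that is linear in the gradient error (\<open>inexact_nesterov_step\<close>); with errors decaying like
  \<open>(1 - \<alpha>/2)\<^sup>k\<close> the potential decays at the same rate (\<open>inexact_potential_decay\<close>), and it dominates
  \<open>\<parallel>y\<^sub>k - s\<parallel>\<^sup>2\<close> for the dual optimum \<open>s\<close>. Finally \<open>M\<close> is Lipschitz and \<open>M s = X\<^sub>\<star>\<close>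
  (\<open>primal_lipschitz\<close>), so the primal error follows from the dual one.

  The initial error is bounded by \<open>\<Delta>\<^sub>d\<^sub>u\<^sub>a\<^sub>l = F(X\<^sub>\<star>) - min F\<close> (\<open>dual_gap_eq\<close>, strong duality): the
  optimality condition says that \<open>\<nabla>F(X\<^sub>\<star>)\<close> is orthogonal to the consensus space, which is the
  kernel of \<open>A\<close>, so it lies in the range of \<open>A\<close> and hence equals \<open>- S s\<close> for some \<open>s\<close>.
  This gives the bound with the constant 17, which is at most 258. A mixing matrix without positive
  eigenvalues (a single node) is a degenerate case in which both sides of the bound vanish.

  Smoothness and strong convexity enter only through quadratic upper and lower bounds
  (\<open>quad_bounds\<close>), which are stable under all the constructions needed. Spectral facts about \<open>W\<close>
  are obtained from the spectral theorem for self-adjoint operators on a Euclidean space.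
\<close>

section \<open>The spectral theorem for self-adjoint operators\<close>

definition selfadjoint :: "('a::real_inner \<Rightarrow> 'a) \<Rightarrow> bool" where
  "selfadjoint T \<longleftrightarrow> linear T \<and> (\<forall>x y. T x \<bullet> y = x \<bullet> T y)"

text \<open>First-order condition for a quadratic polynomial in one variable that is minimal at 0; it turns
  the extremality of a Rayleigh quotient into an eigenvalue equation.\<close>

lemma linear_coeff_zero_if_quadratic_nonneg:
  fixes b c :: real
  assumes "\<And>t. 0 \<le> 2 * t * b + t\<^sup>2 * c"
  shows "b = 0"
proof (rule ccontr)
  assume "b \<noteq> 0"
  define K where "K = \<bar>c\<bar> + 1"
  have "K > 0" "c < K" by (auto simp: K_def)
  \<comment> \<open>The linear term has order t and the quadratic one order t squared; this t is small enough for the former to win.\<close>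
  have "0 \<le> 2 * (- b / K) * b + (- b / K)\<^sup>2 * c" by (rule assms)
  also have "\<dots> = (b\<^sup>2 / K) * (c / K - 2)"
    using \<open>K > 0\<close> by (simp add: field_simps power2_eq_square)
  also have "\<dots> < 0"
  proof (rule mult_pos_neg)
    show "0 < b\<^sup>2 / K" using \<open>b \<noteq> 0\<close> \<open>K > 0\<close> by simp
    have "c / K < 1" using \<open>c < K\<close> \<open>K > 0\<close> by simp
    then show "c / K - 2 < 0" by simp
  qed
  finally show False by simp
qed

text \<open>A maximizer \<open>v\<close> of the Rayleigh quotient on the compact unit sphere of the subspace is an
  eigenvector: with \<open>l\<close> the maximum, the form \<open>l \<parallel>x\<parallel>\<^sup>2 - x \<bullet> T x\<close> is nonnegative on the subspace and
  vanishes at \<open>v\<close>, so its derivative at \<open>v\<close> in the direction \<open>l v - T v\<close> vanishes too.\<close>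

lemma selfadjoint_eigenvector_in_invariant_subspace:
  fixes T :: "'a::euclidean_space \<Rightarrow> 'a"
  assumes T: "selfadjoint T" and V: "subspace V" "T ` V \<subseteq> V" and w: "w \<in> V" "w \<noteq> 0"
  obtains v l where "v \<in> V" "norm v = 1" "T v = l *\<^sub>R v"
proof -
  have lin: "linear T" and sym: "\<And>x y. T x \<bullet> y = x \<bullet> T y"
    using T by (auto simp: selfadjoint_def)
  define K where "K = V \<inter> sphere 0 1"
  have "compact K"
    unfolding K_def using V(1) by (simp add: closed_Int_compact closed_subspace)
  moreover have "(1 / norm w) *\<^sub>R w \<in> K"
    unfolding K_def using w V(1) by (auto simp: subspace_scale)
  then have "K \<noteq> {}" by auto
  moreover have "continuous_on K (\<lambda>x. x \<bullet> T x)"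
    using lin by (intro continuous_intros linear_continuous_on linear_conv_bounded_linear[THEN iffD1])
  ultimately obtain v where v: "v \<in> K" "\<And>x. x \<in> K \<Longrightarrow> x \<bullet> T x \<le> v \<bullet> T v"
    using continuous_attains_sup[of K "\<lambda>x. x \<bullet> T x"] by blast
  have vV: "v \<in> V" and nv: "norm v = 1" using v(1) by (auto simp: K_def)
  define l where "l = v \<bullet> T v"
  have bound: "0 \<le> l * (x \<bullet> x) - x \<bullet> T x" if "x \<in> V" for x
  proof (cases "x = 0")
    case False
    have "(1 / norm x) *\<^sub>R x \<in> K"
      using that False V(1) by (auto simp: K_def subspace_scale)
    from v(2)[OF this] have "(x \<bullet> T x) / (norm x)\<^sup>2 \<le> l"
      using lin by (simp add: l_def linear_scale power2_eq_square)
    then show ?thesis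
      using False by (simp add: divide_le_eq power2_norm_eq_inner)
  qed (use lin in \<open>simp add: linear_0\<close>)
  define d where "d = l *\<^sub>R v - T v"
  have dV: "d \<in> V" unfolding d_def using vV V by (auto simp: subspace_diff subspace_scale)
  have vv: "v \<bullet> v = 1" using nv by (simp add: norm_eq_1)
  have "d \<bullet> d = 0"
  proof (rule linear_coeff_zero_if_quadratic_nonneg)
    fix t :: real
    have "v + t *\<^sub>R d \<in> V" using vV dV V(1) by (auto simp: subspace_add subspace_scale)
    from bound[OF this] have "0 \<le> l * ((v + t *\<^sub>R d) \<bullet> (v + t *\<^sub>R d)) - (v + t *\<^sub>R d) \<bullet> T (v + t *\<^sub>R d)" .
    also have "\<dots> = 2 * t * (d \<bullet> (l *\<^sub>R v - T v)) + t\<^sup>2 * (l * (d \<bullet> d) - d \<bullet> T d)"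
      using sym[of v d] vv
      by (simp add: linear_add[OF lin] linear_scale[OF lin] inner_simps inner_commute
          algebra_simps power2_eq_square l_def)
    finally show "0 \<le> 2 * t * (d \<bullet> d) + t\<^sup>2 * (l * (d \<bullet> d) - d \<bullet> T d)"
      by (simp add: d_def)
  qed
  then have "T v = l *\<^sub>R v" by (simp add: d_def)
  with vV nv that show thesis by blast
qed

definition orthonormal :: "'a::real_inner set \<Rightarrow> bool" where
  "orthonormal B \<longleftrightarrow> pairwise orthogonal B \<and> (\<forall>b\<in>B. norm b = 1)"

text \<open>Induction on the dimension: the orthogonal complement of an eigenvector inside an invariant
  subspace is again invariant, because \<open>T\<close> is self-adjoint.\<close>

lemma spectral_theorem_invariant_subspace:
  fixes T :: "'a::euclidean_space \<Rightarrow> 'a"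
  assumes T: "selfadjoint T" and "subspace V" "T ` V \<subseteq> V"
  shows "\<exists>B l. B \<subseteq> V \<and> orthonormal B \<and> span B = V \<and> (\<forall>b\<in>B. T b = l b *\<^sub>R b)"
  using assms(2,3)
proof (induction "dim V" arbitrary: V rule: less_induct)
  case less
  show ?case
  proof (cases "V \<subseteq> {0}")
    case True
    then have "V = {0}" using less.prems(1) subspace_0 by blast
    then show ?thesis by (intro exI[of _ "{}"]) (auto simp: orthonormal_def)
  next
    case False
    then obtain w where "w \<in> V" "w \<noteq> 0" by auto
    from selfadjoint_eigenvector_in_invariant_subspace[OF T less.prems this]
    obtain v lv where v: "v \<in> V" "norm v = 1" "T v = lv *\<^sub>R v" .
    have vv: "v \<bullet> v = 1" using v(2) by (simp add: norm_eq_1)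
    define U where "U = V \<inter> {x. v \<bullet> x = 0}"
    have U: "subspace U" unfolding U_def by (intro subspace_inter less.prems subspace_hyperplane)
    have TU: "T ` U \<subseteq> U"
    proof
      fix y assume "y \<in> T ` U"
      then obtain x where x: "x \<in> U" "y = T x" by auto
      have "v \<bullet> T x = T v \<bullet> x" using T by (simp add: selfadjoint_def)
      with x v(3) less.prems(2) show "y \<in> U" by (auto simp: U_def)
    qed
    have "v \<notin> U" using vv by (simp add: U_def)
    then have "U \<subset> V" using v(1) unfolding U_def by blast
    then have "dim U < dim V"
      using U less.prems(1) by (intro dim_psubset) (simp add: span_eq_iff[THEN iffD2])
    from less.hyps[OF this U TU] obtain B l where
      B: "B \<subseteq> U" "orthonormal B" "span B = U" "\<forall>b\<in>B. T b = l b *\<^sub>R b" by auto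
    have "span (insert v B) = V"
    proof
      show "span (insert v B) \<subseteq> V"
        using v(1) B(1) by (intro span_minimal less.prems(1)) (auto simp: U_def)
      show "V \<subseteq> span (insert v B)"
      proof
        fix x assume "x \<in> V"
        then have "x - (v \<bullet> x) *\<^sub>R v \<in> U"
          using v(1) vv less.prems(1) by (auto simp: U_def inner_simps subspace_diff subspace_scale)
        then show "x \<in> span (insert v B)" using B(3) span_breakdown_eq by blast
      qed
    qed
    moreover have "orthonormal (insert v B)"
      using B(1,2) v(2) by (auto simp: orthonormal_def pairwise_insert U_def orthogonal_def inner_commute)
    moreover have "\<forall>b\<in>insert v B. T b = (l(v := lv)) b *\<^sub>R b"
      using B(4) v(3) B(1) \<open>v \<notin> U\<close> by auto
    moreover have "insert v B \<subseteq> V" using v(1) B(1) by (auto simp: U_def)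
    ultimately show ?thesis by blast
  qed
qed

lemma orthonormal_inner:
  "orthonormal B \<Longrightarrow> b \<in> B \<Longrightarrow> c \<in> B \<Longrightarrow> b \<bullet> c = (if b = c then 1 else 0)"
  by (auto simp: orthonormal_def pairwise_def orthogonal_def norm_eq_1)

lemma orthonormal_combination_inner:
  assumes "finite B" "orthonormal B" "c \<in> B"
  shows "(\<Sum>b\<in>B. u b *\<^sub>R b) \<bullet> c = u c"
proof -
  have "(\<Sum>b\<in>B. u b *\<^sub>R b) \<bullet> c = (\<Sum>b\<in>B. if b = c then u c else 0)"
    unfolding inner_sum_left
    by (rule sum.cong) (auto simp: orthonormal_inner[OF assms(2) _ assms(3)])
  then show ?thesis using assms by simp
qed

lemma orthonormal_expansion:
  assumes "finite B" "orthonormal B" "span B = UNIV"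
  shows "(\<Sum>b\<in>B. (x \<bullet> b) *\<^sub>R b) = x"
proof -
  have "x \<in> span B" using assms(3) by simp
  then obtain u where u: "x = (\<Sum>b\<in>B. u b *\<^sub>R b)"
    using span_finite[OF assms(1)] by auto
  have "x \<bullet> b = u b" if "b \<in> B" for b
    unfolding u by (rule orthonormal_combination_inner[OF assms(1,2) that])
  then have "(\<Sum>b\<in>B. (x \<bullet> b) *\<^sub>R b) = (\<Sum>b\<in>B. u b *\<^sub>R b)" by simp
  then show ?thesis by (simp only: u[symmetric])
qed

theorem spectral_theorem:
  fixes T :: "'a::euclidean_space \<Rightarrow> 'a"
  assumes "selfadjoint T"
  obtains B l where "finite B" "orthonormal B" "\<And>x. (\<Sum>b\<in>B. (x \<bullet> b) *\<^sub>R b) = x"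
    "\<And>b. b \<in> B \<Longrightarrow> T b = l b *\<^sub>R b"
proof -
  from spectral_theorem_invariant_subspace[OF assms, of UNIV] obtain B l where
    B: "orthonormal B" "span B = UNIV" "\<forall>b\<in>B. T b = l b *\<^sub>R b" by auto
  have "finite B" using B(1) by (simp add: orthonormal_def pairwise_orthogonal_imp_finite)
  with B that orthonormal_expansion show thesis by metis
qed

section \<open>Positive semidefinite square roots and spectral bounds\<close>

lemma psd_op_imp_selfadjoint: "psd_op T \<Longrightarrow> selfadjoint T"
  by (simp add: psd_op_def selfadjoint_def)

lemma orthonormal_parseval:
  assumes "\<And>x. (\<Sum>b\<in>B. (x \<bullet> b) *\<^sub>R b) = x"
  shows "x \<bullet> y = (\<Sum>b\<in>B. (x \<bullet> b) * (y \<bullet> b))"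
proof -
  have "x \<bullet> y = (\<Sum>b\<in>B. (x \<bullet> b) *\<^sub>R b) \<bullet> y" by (simp only: assms)
  then show ?thesis by (simp only: inner_sum_left inner_scaleR_left inner_commute[of y])
qed

lemma orthonormal_parseval_norm:
  assumes "\<And>x. (\<Sum>b\<in>B. (x \<bullet> b) *\<^sub>R b) = x"
  shows "(norm x)\<^sup>2 = (\<Sum>b\<in>B. (x \<bullet> b)\<^sup>2)"
proof -
  have "(norm x)\<^sup>2 = x \<bullet> x" by (rule power2_norm_eq_inner)
  also have "\<dots> = (\<Sum>b\<in>B. (x \<bullet> b) * (x \<bullet> b))" by (rule orthonormal_parseval[OF assms])
  finally show ?thesis by (simp only: power2_eq_square)
qed

lemma selfadjoint_quadratic_form:
  assumes T: "selfadjoint T" and "\<And>x. (\<Sum>b\<in>B. (x \<bullet> b) *\<^sub>R b) = x"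
    and "\<And>b. b \<in> B \<Longrightarrow> T b = l b *\<^sub>R b"
  shows "x \<bullet> T x = (\<Sum>b\<in>B. l b * (x \<bullet> b)\<^sup>2)"
proof -
  have Tb: "T x \<bullet> b = l b * (x \<bullet> b)" if "b \<in> B" for b
    using T assms(3)[OF that] by (simp add: selfadjoint_def)
  have "x \<bullet> T x = (\<Sum>b\<in>B. (x \<bullet> b) * (T x \<bullet> b))"
    by (rule orthonormal_parseval[OF assms(2)])
  also have "\<dots> = (\<Sum>b\<in>B. l b * (x \<bullet> b)\<^sup>2)"
    by (rule sum.cong) (simp_all add: Tb power2_eq_square)
  finally show ?thesis .
qed

text \<open>An eigenbasis is used only through its expansion formula, so equality of linear maps is checked
  on the basis in this form.\<close>

lemma linear_ext_expansion:
  assumes "linear S" "linear T" "\<And>x. (\<Sum>b\<in>B. (x \<bullet> b) *\<^sub>R b) = x"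
    and "\<And>b. b \<in> B \<Longrightarrow> S b = T b"
  shows "S = T"
proof
  fix x
  have "S (\<Sum>b\<in>B. (x \<bullet> b) *\<^sub>R b) = T (\<Sum>b\<in>B. (x \<bullet> b) *\<^sub>R b)"
    by (simp add: linear_sum[OF assms(1)] linear_sum[OF assms(2)]
        linear_scale[OF assms(1)] linear_scale[OF assms(2)] assms(4))
  then show "S x = T x" by (simp only: assms(3))
qed

text \<open>On an eigenvector \<open>b\<close> of \<open>S\<close> with eigenvalue \<open>s\<close> one has \<open>T (T b) = s\<^sup>2 b\<close>, hence
  \<open>(T + s) (T - s) b = 0\<close>. So \<open>w = T b - s b\<close> satisfies \<open>T w = - s w\<close>; positivity of \<open>T\<close> leaves
  only \<open>w = 0\<close> or \<open>s = 0\<close>, and in the latter case \<open>\<parallel>T b\<parallel>\<^sup>2 = b \<bullet> T (T b) = 0\<close>.\<close>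

lemma psd_op_sqrt_unique:
  fixes S T :: "'a::euclidean_space \<Rightarrow> 'a"
  assumes S: "psd_op S" and T: "psd_op T" and eq: "S \<circ> S = T \<circ> T"
  shows "S = T"
proof -
  obtain B s where fin: "finite B" and ON: "orthonormal B"
    and expand: "\<And>x. (\<Sum>b\<in>B. (x \<bullet> b) *\<^sub>R b) = x"
    and eig: "\<And>b. b \<in> B \<Longrightarrow> S b = s b *\<^sub>R b"
    using spectral_theorem[OF psd_op_imp_selfadjoint[OF S]] by blast
  have lin: "linear S" "linear T" using S T by (auto simp: psd_op_def)
  show ?thesis
  proof (rule linear_ext_expansion[OF lin expand])
    fix b assume b: "b \<in> B"
    have "b \<bullet> b = 1" using ON b by (simp add: orthonormal_inner)
    then have s0: "0 \<le> s b" using S eig[OF b] by (metis psd_op_def inner_scaleR_right mult.right_neutral)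
    have TT: "T (T b) = (s b)\<^sup>2 *\<^sub>R b"
      using fun_cong[OF eq, of b] eig[OF b] by (simp add: linear_scale[OF lin(1)] power2_eq_square)
    define w where "w = T b - s b *\<^sub>R b"
    have "T w = - s b *\<^sub>R w"
      unfolding w_def by (simp add: linear_diff[OF lin(2)] linear_scale[OF lin(2)] TT
          algebra_simps power2_eq_square)
    moreover have "0 \<le> w \<bullet> T w" using T by (simp add: psd_op_def)
    ultimately have "s b * (w \<bullet> w) \<le> 0" by simp
    then have "s b = 0 \<or> w = 0"
      using s0 inner_ge_zero[of w] by (metis inner_eq_zero_iff mult_eq_0_iff mult_nonneg_nonneg order_antisym)
    moreover have "T b = 0" if "s b = 0"
    proof -
      have "T b \<bullet> T b = b \<bullet> T (T b)" using T by (simp add: psd_op_def)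
      then show ?thesis using TT that by simp
    qed
    ultimately show "S b = T b" using eig[OF b] by (auto simp: w_def)
  qed
qed

lemma psd_op_sqrt_exists:
  fixes A :: "'a::euclidean_space \<Rightarrow> 'a"
  assumes A: "psd_op A"
  shows "\<exists>S. psd_op S \<and> S \<circ> S = A"
proof -
  obtain B l where fin: "finite B" and ON: "orthonormal B"
    and expand: "\<And>x. (\<Sum>b\<in>B. (x \<bullet> b) *\<^sub>R b) = x"
    and eig: "\<And>b. b \<in> B \<Longrightarrow> A b = l b *\<^sub>R b"
    using spectral_theorem[OF psd_op_imp_selfadjoint[OF A]] by blast
  have l0: "0 \<le> l b" if "b \<in> B" for b
    using A eig[OF that] orthonormal_inner[OF ON that that]
    by (metis psd_op_def inner_scaleR_right mult.right_neutral)
  define S where "S x = (\<Sum>b\<in>B. (sqrt (l b) * (x \<bullet> b)) *\<^sub>R b)" for x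
  have lin: "linear S"
    by (rule linearI) (simp_all add: S_def inner_add_left distrib_left scaleR_add_left sum.distrib scaleR_sum_right mult_ac)
  have form: "S x \<bullet> y = (\<Sum>b\<in>B. sqrt (l b) * (x \<bullet> b) * (y \<bullet> b))" for x y
    by (simp only: S_def inner_sum_left inner_scaleR_left inner_commute[of y])
  have "psd_op S"
    unfolding psd_op_def
  proof (intro conjI allI lin)
    fix x y
    show "S x \<bullet> y = x \<bullet> S y" unfolding inner_commute[of x "S y"] form by (simp add: mult_ac)
    show "0 \<le> x \<bullet> S x"
      unfolding inner_commute[of x "S x"] form
      by (intro sum_nonneg) (simp add: l0 mult.assoc)
  qed
  moreover have "S \<circ> S = A"
  proof (rule linear_ext_expansion[OF _ _ expand])
    show "linear (S \<circ> S)" using lin by (intro linear_compose)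
    show "linear A" using A by (simp add: psd_op_def)
    fix b assume b: "b \<in> B"
    have "S b = (\<Sum>c\<in>B. if c = b then sqrt (l b) *\<^sub>R b else 0)"
      unfolding S_def by (rule sum.cong) (auto simp: orthonormal_inner[OF ON b])
    then have "S b = sqrt (l b) *\<^sub>R b" using b fin by simp
    then show "(S \<circ> S) b = A b" using l0[OF b] eig[OF b] by (simp add: linear_scale[OF lin])
  qed
  ultimately show ?thesis by blast
qed

lemma psd_sqrt:
  fixes A :: "'a::euclidean_space \<Rightarrow> 'a"
  assumes "psd_op A"
  shows "psd_op (psd_sqrt A)" "psd_sqrt A (psd_sqrt A x) = A x"
proof -
  have "\<exists>!S. psd_op S \<and> S \<circ> S = A"
    using psd_op_sqrt_exists[OF assms] psd_op_sqrt_unique by metis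
  from theI'[OF this] have *: "psd_op (psd_sqrt A) \<and> psd_sqrt A \<circ> psd_sqrt A = A"
    unfolding psd_sqrt_def .
  then show "psd_op (psd_sqrt A)" by simp
  from * have "(psd_sqrt A \<circ> psd_sqrt A) x = A x" by simp
  then show "psd_sqrt A (psd_sqrt A x) = A x" by simp
qed

text \<open>Eigenvalues of an operator rather than a matrix, so that the spectral theorem can be applied to
  the Kronecker product without choosing a basis of the stacked space.\<close>

definition op_eigenvalues :: "('a::real_inner \<Rightarrow> 'a) \<Rightarrow> real set" where
  "op_eigenvalues T = {l. \<exists>v. v \<noteq> 0 \<and> T v = l *\<^sub>R v}"

lemma eigenbasis_op_eigenvalue:
  assumes "orthonormal B" "b \<in> B" "T b = l *\<^sub>R b"
  shows "l \<in> op_eigenvalues T"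
  using assms by (auto simp: op_eigenvalues_def orthonormal_def intro!: exI[of _ b])

lemma finite_op_eigenvalues:
  fixes T :: "'a::euclidean_space \<Rightarrow> 'a"
  assumes T: "selfadjoint T"
  shows "finite (op_eigenvalues T)"
proof -
  obtain B l where fin: "finite B" and ON: "orthonormal B"
    and expand: "\<And>x. (\<Sum>b\<in>B. (x \<bullet> b) *\<^sub>R b) = x"
    and eig: "\<And>b. b \<in> B \<Longrightarrow> T b = l b *\<^sub>R b"
    using spectral_theorem[OF T] by blast
  have "op_eigenvalues T \<subseteq> l ` B"
  proof
    fix m assume "m \<in> op_eigenvalues T"
    then obtain v where v: "v \<noteq> 0" "T v = m *\<^sub>R v" by (auto simp: op_eigenvalues_def)
    have "\<exists>b\<in>B. v \<bullet> b \<noteq> 0"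
    proof (rule ccontr)
      assume "\<not> (\<exists>b\<in>B. v \<bullet> b \<noteq> 0)"
      then have "(\<Sum>b\<in>B. (v \<bullet> b) *\<^sub>R b) = 0" by simp
      then show False using expand[of v] v(1) by simp
    qed
    then obtain b where b: "b \<in> B" "v \<bullet> b \<noteq> 0" by blast
    have "T v \<bullet> b = v \<bullet> T b" using T by (simp add: selfadjoint_def)
    then have "m = l b" using v(2) eig[OF b(1)] b(2) by simp
    then show "m \<in> l ` B" using b(1) by simp
  qed
  then show ?thesis using fin by (meson finite_surj)
qed

lemma op_eigenvalues_nonempty:
  fixes T :: "'a::euclidean_space \<Rightarrow> 'a"
  assumes T: "selfadjoint T"
  shows "op_eigenvalues T \<noteq> {}"
proof -
  obtain B l where fin: "finite B" and ON: "orthonormal B"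
    and expand: "\<And>x. (\<Sum>b\<in>B. (x \<bullet> b) *\<^sub>R b) = x"
    and eig: "\<And>b. b \<in> B \<Longrightarrow> T b = l b *\<^sub>R b"
    using spectral_theorem[OF T] by blast
  obtain x :: 'a where "x \<noteq> 0" using nonzero_Basis SOME_Basis by blast
  then have "B \<noteq> {}" using expand[of x] by auto
  then obtain b where b: "b \<in> B" by blast
  then show ?thesis using eigenbasis_op_eigenvalue[of B b T "l b", OF ON b eig[OF b]] by blast
qed

lemma selfadjoint_quadratic_form_le:
  fixes T :: "'a::euclidean_space \<Rightarrow> 'a"
  assumes T: "selfadjoint T" and "\<And>l. l \<in> op_eigenvalues T \<Longrightarrow> l \<le> M"
  shows "x \<bullet> T x \<le> M * (norm x)\<^sup>2"
proof -
  obtain B l where fin: "finite B" and ON: "orthonormal B"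
    and expand: "\<And>x. (\<Sum>b\<in>B. (x \<bullet> b) *\<^sub>R b) = x"
    and eig: "\<And>b. b \<in> B \<Longrightarrow> T b = l b *\<^sub>R b"
    using spectral_theorem[OF T] by blast
  have "x \<bullet> T x = (\<Sum>b\<in>B. l b * (x \<bullet> b)\<^sup>2)"
    by (rule selfadjoint_quadratic_form[OF T expand eig])
  also have "\<dots> \<le> (\<Sum>b\<in>B. M * (x \<bullet> b)\<^sup>2)"
  proof (rule sum_mono)
    fix b assume b: "b \<in> B"
    show "l b * (x \<bullet> b)\<^sup>2 \<le> M * (x \<bullet> b)\<^sup>2"
      using assms(2)[OF eigenbasis_op_eigenvalue[of B b T "l b", OF ON b eig[OF b]]] by (rule mult_right_mono) simp
  qed
  also have "\<dots> = M * (norm x)\<^sup>2"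
    by (simp add: orthonormal_parseval_norm[OF expand] sum_distrib_left)
  finally show ?thesis .
qed

text \<open>The range is the orthogonal complement of the kernel: divide the coordinates of \<open>y\<close> by the
  eigenvalues.\<close>

lemma selfadjoint_range:
  fixes T :: "'a::euclidean_space \<Rightarrow> 'a"
  assumes T: "selfadjoint T" and perp: "\<And>z. T z = 0 \<Longrightarrow> y \<bullet> z = 0"
  shows "\<exists>z. T z = y"
proof -
  obtain B l where fin: "finite B" and ON: "orthonormal B"
    and expand: "\<And>x. (\<Sum>b\<in>B. (x \<bullet> b) *\<^sub>R b) = x"
    and eig: "\<And>b. b \<in> B \<Longrightarrow> T b = l b *\<^sub>R b"
    using spectral_theorem[OF T] by blast
  have lin: "linear T" using T by (simp add: selfadjoint_def)
  \<comment> \<open>Where the eigenvalue is 0 the coordinate of y vanishes, so division by 0 is harmless.\<close>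
  have "T (\<Sum>b\<in>B. ((y \<bullet> b) / l b) *\<^sub>R b) = (\<Sum>b\<in>B. (y \<bullet> b) *\<^sub>R b)"
    unfolding linear_sum[OF lin]
  proof (rule sum.cong)
    fix b assume "b \<in> B"
    then show "T (((y \<bullet> b) / l b) *\<^sub>R b) = (y \<bullet> b) *\<^sub>R b"
      using eig[of b] perp[of b] by (cases "l b = 0") (auto simp: linear_scale[OF lin] linear_0[OF lin])
  qed simp
  then show ?thesis using expand by metis
qed

text \<open>Every value of \<open>A\<close> is attained at a vector without kernel component, and on such vectors the
  quadratic form is bounded below by the smallest positive eigenvalue.\<close>

lemma psd_op_spectral_gap:
  fixes A :: "'a::euclidean_space \<Rightarrow> 'a"
  assumes A: "psd_op A" and gap: "\<And>l. l \<in> op_eigenvalues A \<Longrightarrow> 0 < l \<Longrightarrow> m \<le> l"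
  shows "\<exists>z. A z = A x \<and> m * (norm z)\<^sup>2 \<le> z \<bullet> A z"
proof -
  have sa: "selfadjoint A" and lin: "linear A"
    using A by (auto simp: psd_op_def selfadjoint_def)
  obtain B l where fin: "finite B" and ON: "orthonormal B"
    and expand: "\<And>x. (\<Sum>b\<in>B. (x \<bullet> b) *\<^sub>R b) = x"
    and eig: "\<And>b. b \<in> B \<Longrightarrow> A b = l b *\<^sub>R b"
    using spectral_theorem[OF sa] by blast
  have l0: "0 \<le> l b" if "b \<in> B" for b
    using A eig[OF that] orthonormal_inner[OF ON that that]
    by (metis psd_op_def inner_scaleR_right mult.right_neutral)
  define z where "z = (\<Sum>b\<in>B. (if l b = 0 then 0 else x \<bullet> b) *\<^sub>R b)"
  have zb: "z \<bullet> b = (if l b = 0 then 0 else x \<bullet> b)" if "b \<in> B" for b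
    unfolding z_def by (rule orthonormal_combination_inner[OF fin ON that])
  have "A z = A (\<Sum>b\<in>B. (x \<bullet> b) *\<^sub>R b)"
    unfolding z_def linear_sum[OF lin]
    by (rule sum.cong) (auto simp: linear_scale[OF lin] eig)
  then have "A z = A x" by (simp only: expand)
  moreover have "m * (norm z)\<^sup>2 \<le> z \<bullet> A z"
  proof -
    have "m * (norm z)\<^sup>2 = (\<Sum>b\<in>B. m * (z \<bullet> b)\<^sup>2)"
      by (simp add: orthonormal_parseval_norm[OF expand] sum_distrib_left)
    also have "\<dots> \<le> (\<Sum>b\<in>B. l b * (z \<bullet> b)\<^sup>2)"
    proof (rule sum_mono)
      fix b assume b: "b \<in> B"
      show "m * (z \<bullet> b)\<^sup>2 \<le> l b * (z \<bullet> b)\<^sup>2"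
        using zb[OF b] gap[OF eigenbasis_op_eigenvalue[of B b A "l b", OF ON b eig[OF b]]] l0[OF b]
        by (cases "l b = 0") (auto intro!: mult_right_mono)
    qed
    also have "\<dots> = z \<bullet> A z"
      by (rule selfadjoint_quadratic_form[OF sa expand eig, symmetric])
    finally show ?thesis .
  qed
  ultimately show ?thesis by blast
qed

section \<open>Functions between two quadratics, their minimizers and conjugates\<close>

text \<open>For a function with gradient \<open>g\<close>, the lower bound is strong convexity with modulus \<open>m\<close> and the
  upper bound is what Lipschitz continuity of \<open>g\<close> with constant \<open>K\<close> provides. These
  inequalities pass to sums and quadratic perturbations, and they force \<open>g x = 0\<close> at minimizers,
  so optimality conditions need no derivatives.\<close>

definition quad_bounds :: "real \<Rightarrow> real \<Rightarrow> ('a::real_inner \<Rightarrow> real) \<Rightarrow> ('a \<Rightarrow> 'a) \<Rightarrow> bool" where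
  "quad_bounds m K F g \<longleftrightarrow> (\<forall>x y.
     F x + g x \<bullet> (y - x) + m / 2 * (norm (y - x))\<^sup>2 \<le> F y \<and>
     F y \<le> F x + g x \<bullet> (y - x) + K / 2 * (norm (y - x))\<^sup>2)"

lemma quad_bounds_lower:
  "quad_bounds m K F g \<Longrightarrow> F x + g x \<bullet> (y - x) + m / 2 * (norm (y - x))\<^sup>2 \<le> F y"
  by (simp add: quad_bounds_def)

lemma quad_bounds_upper:
  "quad_bounds m K F g \<Longrightarrow> F y \<le> F x + g x \<bullet> (y - x) + K / 2 * (norm (y - x))\<^sup>2"
  by (simp add: quad_bounds_def)

lemma GDERIV_along_line:
  assumes "GDERIV f (x + t *\<^sub>R d) :> G"
  shows "((\<lambda>t. f (x + t *\<^sub>R d)) has_real_derivative (G \<bullet> d)) (at t)"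
proof -
  have "((\<lambda>t. x + t *\<^sub>R d) has_derivative (\<lambda>h. h *\<^sub>R d)) (at t)"
    by (auto intro!: derivative_eq_intros)
  moreover have "(\<lambda>h. (h *\<^sub>R d) \<bullet> G) = (*) (G \<bullet> d)" by (auto simp: inner_commute)
  ultimately show ?thesis
    using has_derivative_compose[of "\<lambda>t. x + t *\<^sub>R d" _ t UNIV f, OF _ assms[unfolded gderiv_def]]
    unfolding has_field_derivative_def by metis
qed

text \<open>Both bounds follow on the segment from \<open>x\<close> to \<open>y\<close>. Strong convexity makes
  \<open>f - \<mu>/2 \<parallel>\<cdot>\<parallel>\<^sup>2\<close> convex there, so it lies above its tangent; smoothness makes the difference of
  \<open>f\<close> and the claimed upper bound nonincreasing.\<close>

lemma quad_bounds_of_smooth_strongly_convex: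
  assumes "L_smooth L f" "strongly_convex \<mu> f"
  shows "\<exists>g. quad_bounds \<mu> L f g"
proof -
  obtain g where g: "\<And>x. GDERIV f x :> g x" and lip: "L-lipschitz_on UNIV g"
    using assms(1) by (auto simp: L_smooth_def)
  have "f x + g x \<bullet> (y - x) + \<mu> / 2 * (norm (y - x))\<^sup>2 \<le> f y" for x y
  proof -
    define d where "d = y - x"
    define \<psi> where "\<psi> t = f (x + t *\<^sub>R d) - \<mu> / 2 * (norm (x + t *\<^sub>R d))\<^sup>2" for t
    have cvx: "convex_on UNIV \<psi>"
    proof (rule convex_onI)
      fix t a b :: real assume t: "0 < t" "t < 1"
      have "x + ((1 - t) *\<^sub>R a + t *\<^sub>R b) *\<^sub>R d = (1 - t) *\<^sub>R (x + a *\<^sub>R d) + t *\<^sub>R (x + b *\<^sub>R d)"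
        by (simp add: algebra_simps)
      then show "\<psi> ((1 - t) *\<^sub>R a + t *\<^sub>R b) \<le> (1 - t) * \<psi> a + t * \<psi> b"
        unfolding \<psi>_def
        using convex_onD[OF assms(2)[unfolded strongly_convex_def], of t "x + a *\<^sub>R d" "x + b *\<^sub>R d"] t
        by simp
    qed simp
    have sq: "(norm (x + t *\<^sub>R d))\<^sup>2 = x \<bullet> x + 2 * t * (x \<bullet> d) + t\<^sup>2 * (d \<bullet> d)" for t
      by (simp only: power2_norm_eq_inner)
        (simp add: inner_simps inner_commute[of d x] power2_eq_square algebra_simps)
    have "(\<psi> has_real_derivative (g x \<bullet> d - \<mu> * (x \<bullet> d))) (at 0)"
      unfolding \<psi>_def sq
      by (rule derivative_eq_intros GDERIV_along_line[OF g] refl | simp)+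
    then have "\<psi> 1 - \<psi> 0 \<ge> (g x \<bullet> d - \<mu> * (x \<bullet> d)) * (1 - 0)"
      by (intro convex_on_imp_above_tangent[OF cvx]) auto
    then have "f y \<ge> f x + g x \<bullet> d + \<mu> / 2 * (d \<bullet> d)"
      unfolding \<psi>_def sq by (simp add: d_def algebra_simps)
    then show ?thesis by (simp add: d_def power2_norm_eq_inner)
  qed
  moreover have "f y \<le> f x + g x \<bullet> (y - x) + L / 2 * (norm (y - x))\<^sup>2" for x y
  proof -
    define d where "d = y - x"
    define \<phi> where "\<phi> t = f (x + t *\<^sub>R d) - t * (g x \<bullet> d) - L / 2 * t\<^sup>2 * (norm d)\<^sup>2" for t
    have "\<phi> 1 \<le> \<phi> 0"
    proof (rule DERIV_nonpos_imp_nonincreasing[of 0 1 \<phi>])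
      fix t :: real assume t: "0 \<le> t" "t \<le> 1"
      have "(\<phi> has_real_derivative (g (x + t *\<^sub>R d) \<bullet> d - g x \<bullet> d - L * t * (norm d)\<^sup>2)) (at t)"
        unfolding \<phi>_def
        by (rule derivative_eq_intros GDERIV_along_line[OF g] refl | simp)+
      moreover have "(g (x + t *\<^sub>R d) - g x) \<bullet> d \<le> L * t * (norm d)\<^sup>2"
      proof -
        have "(g (x + t *\<^sub>R d) - g x) \<bullet> d \<le> norm (g (x + t *\<^sub>R d) - g x) * norm d"
          by (rule norm_cauchy_schwarz)
        also have "\<dots> \<le> (L * norm (t *\<^sub>R d)) * norm d"
          using lipschitz_onD[OF lip, of "x + t *\<^sub>R d" x]
          by (intro mult_right_mono) (simp_all add: dist_norm)
        finally show ?thesis using t by (simp add: power2_eq_square mult_ac)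
      qed
      ultimately show "\<exists>D. (\<phi> has_real_derivative D) (at t) \<and> D \<le> 0"
        by (intro exI conjI) (auto simp: inner_diff_left)
    qed simp
    then show ?thesis by (simp add: \<phi>_def d_def)
  qed
  ultimately show ?thesis unfolding quad_bounds_def by blast
qed

lemma quad_bounds_continuous:
  fixes F :: "'a::real_inner \<Rightarrow> real"
  assumes q: "quad_bounds m K F g"
  shows "continuous_on A F"
proof -
  have "isCont F x" for x
  proof -
    have lim: "((\<lambda>y. F x + g x \<bullet> (y - x) + c / 2 * (norm (y - x))\<^sup>2) \<longlongrightarrow> F x) (at x)" for c
    proof -
      have "((\<lambda>y. F x + g x \<bullet> (y - x) + c / 2 * (norm (y - x))\<^sup>2)
        \<longlongrightarrow> F x + g x \<bullet> (x - x) + c / 2 * (norm (x - x))\<^sup>2) (at x)"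
        by (intro tendsto_intros)
      then show ?thesis by simp
    qed
    show ?thesis
      unfolding isCont_def
      by (rule tendsto_sandwich[OF _ _ lim[of m] lim[of K]])
        (intro always_eventually allI quad_bounds_lower[OF q] quad_bounds_upper[OF q])+
  qed
  then show ?thesis by (simp add: continuous_at_imp_continuous_on)
qed

text \<open>A gradient step of length \<open>1 / K\<close> decreases \<open>F\<close> by at least \<open>\<parallel>g x\<parallel>\<^sup>2 / (2 K)\<close>.\<close>

lemma quad_bounds_gradient_zero_at_min:
  assumes q: "quad_bounds m K F g" and "0 < K" and min: "\<And>y. F x \<le> F y"
  shows "g x = 0"
proof -
  have "F (x - (1 / K) *\<^sub>R g x) \<le> F x - (g x \<bullet> g x) / K + K / 2 * ((1 / K)\<^sup>2 * (g x \<bullet> g x))"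
    using quad_bounds_upper[OF q, of "x - (1 / K) *\<^sub>R g x" x]
    by (simp add: power_mult_distrib power_divide power2_norm_eq_inner)
  also have "\<dots> = F x - (g x \<bullet> g x) / (2 * K)"
    using \<open>0 < K\<close> by (simp add: field_simps power2_eq_square)
  finally have "(g x \<bullet> g x) / (2 * K) \<le> 0"
    using min[of "x - (1 / K) *\<^sub>R g x"] by linarith
  then have "g x \<bullet> g x \<le> 0" using \<open>0 < K\<close> by (simp add: divide_le_0_iff)
  then show ?thesis by (metis inner_eq_zero_iff inner_ge_zero order_antisym)
qed

lemma quad_bounds_growth:
  assumes "quad_bounds m K F g" and "g x = 0"
  shows "F x + m / 2 * (norm (y - x))\<^sup>2 \<le> F y"
  using quad_bounds_lower[OF assms(1), of x y] assms(2) by simp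

lemma quad_bounds_critical_point_unique:
  assumes "quad_bounds m K F g" "0 < m" "g x = 0" "F z \<le> F x"
  shows "z = x"
proof -
  have "m / 2 * (norm (z - x))\<^sup>2 \<le> 0"
    using quad_bounds_growth[OF assms(1,3), of z] assms(4) by simp
  then show ?thesis using assms(2) by (simp add: mult_le_0_iff)
qed

text \<open>Outside the ball of radius \<open>R\<close> the quadratic lower bound at 0 exceeds \<open>F 0\<close>, so a minimum over
  the ball is global.\<close>

lemma quad_bounds_minimum_exists:
  fixes F :: "'a::euclidean_space \<Rightarrow> real"
  assumes q: "quad_bounds m K F g" and m: "0 < m"
  shows "\<exists>x. \<forall>y. F x \<le> F y"
proof -
  define R where "R = 2 * norm (g 0) / m"
  have R0: "0 \<le> R" using m by (simp add: R_def)
  obtain x where x: "x \<in> cball 0 R" "\<And>y. y \<in> cball 0 R \<Longrightarrow> F x \<le> F y"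
    using continuous_attains_inf[OF compact_cball _ quad_bounds_continuous[OF q], of 0 R] R0 by auto
  have "F x \<le> F y" for y
  proof (cases "y \<in> cball 0 R")
    case False
    then have "R < norm y" by simp
    then have "2 * norm (g 0) < m * norm y"
      using m by (simp add: R_def pos_divide_less_eq mult.commute)
    then have "norm (g 0) * norm y \<le> m / 2 * (norm y)\<^sup>2"
      using mult_right_mono[of "2 * norm (g 0)" "m * norm y" "norm y"]
      by (simp add: power2_eq_square)
    moreover have "- (norm (g 0) * norm y) \<le> g 0 \<bullet> y"
      using Cauchy_Schwarz_ineq2[of "g 0" y] by linarith
    ultimately have "F 0 \<le> F y" using quad_bounds_lower[OF q, of 0 y] by simp
    moreover have "F x \<le> F 0" using x(2)[of 0] R0 by simp
    ultimately show ?thesis by linarith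
  qed (rule x(2))
  then show ?thesis by blast
qed

lemma quad_bounds_critical_point_exists:
  fixes F :: "'a::euclidean_space \<Rightarrow> real"
  assumes "quad_bounds m K F g" "0 < m" "0 < K"
  shows "\<exists>x. g x = 0"
  using quad_bounds_minimum_exists[OF assms(1,2)]
    quad_bounds_gradient_zero_at_min[OF assms(1,3)] by blast

lemma quad_bounds_ARG_MIN:
  assumes q: "quad_bounds m K F g" and m: "0 < m" and x: "g x = 0"
  shows "(ARG_MIN F y. True) = x"
proof -
  have le: "F x \<le> F y" for y
  proof -
    have "0 \<le> m / 2 * (norm (y - x))\<^sup>2" using m by simp
    then show ?thesis using quad_bounds_growth[OF q x, of y] by linarith
  qed
  then have "is_arg_min F (\<lambda>y. True) x" by (auto simp: is_arg_min_def not_less)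
  then have "is_arg_min F (\<lambda>y. True) (ARG_MIN F y. True)"
    unfolding arg_min_def by (rule someI)
  then have "F (ARG_MIN F y. True) \<le> F x" by (auto simp: is_arg_min_def not_less)
  then show ?thesis by (rule quad_bounds_critical_point_unique[OF q m x])
qed

text \<open>The equality case of the Fenchel inequality: \<open>x\<close> attains the supremum because \<open>F\<close> lies above its
  tangent at \<open>x\<close>.\<close>

lemma conjugate_at_gradient:
  assumes q: "quad_bounds m K F g" and m: "0 \<le> m"
  shows "convex_conjugate F (g x) = g x \<bullet> x - F x"
  unfolding convex_conjugate_def
proof (rule cSup_eq_maximum)
  fix v assume "v \<in> range (\<lambda>y. g x \<bullet> y - F y)"
  then obtain y where "v = g x \<bullet> y - F y" by auto
  moreover have "0 \<le> m / 2 * (norm (y - x))\<^sup>2" using m by simp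
  ultimately show "v \<le> g x \<bullet> x - F x"
    using quad_bounds_lower[OF q, of x y] by (simp add: inner_diff_right)
qed auto

text \<open>Strong convexity is needed here to bound the supremum; for an unbounded family the real-valued
  conjugate would be an unspecified number.\<close>

lemma fenchel_young:
  fixes F :: "'a::euclidean_space \<Rightarrow> real"
  assumes q: "quad_bounds m K F g" and m: "0 < m"
  shows "y \<bullet> x - F x \<le> convex_conjugate F y"
  unfolding convex_conjugate_def
proof (rule cSUP_upper)
  have "y \<bullet> x - F x \<le> (norm (y - g 0))\<^sup>2 / (2 * m) - F 0" for x
  proof -
    have "y \<bullet> x - F x \<le> (y - g 0) \<bullet> x - m / 2 * (norm x)\<^sup>2 - F 0"
      using quad_bounds_lower[OF q, of 0 x] by (simp add: inner_diff_left)
    also have "(y - g 0) \<bullet> x \<le> norm (y - g 0) * norm x" by (rule norm_cauchy_schwarz)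
    also have "norm (y - g 0) * norm x - m / 2 * (norm x)\<^sup>2 - F 0
      = (norm (y - g 0))\<^sup>2 / (2 * m) - F 0 - (norm (y - g 0) - m * norm x)\<^sup>2 / (2 * m)"
      using m by (simp add: field_simps power2_eq_square)
    also have "\<dots> \<le> (norm (y - g 0))\<^sup>2 / (2 * m) - F 0" using m by simp
    finally show ?thesis by simp
  qed
  then show "bdd_above (range (\<lambda>x. y \<bullet> x - F x))" by (intro bdd_aboveI2)
qed simp

lemma quad_bounds_sum:
  assumes "\<And>i. i \<in> I \<Longrightarrow> quad_bounds m K (f i) (g i)"
  shows "quad_bounds (of_nat (card I) * m) (of_nat (card I) * K)
    (\<lambda>x. \<Sum>i\<in>I. f i x) (\<lambda>x. \<Sum>i\<in>I. g i x)"
  unfolding quad_bounds_def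
proof (intro allI conjI)
  fix x y
  have *: "(\<Sum>i\<in>I. f i x) + (\<Sum>i\<in>I. g i x) \<bullet> (y - x) + of_nat (card I) * c / 2 * (norm (y - x))\<^sup>2
    = (\<Sum>i\<in>I. f i x + g i x \<bullet> (y - x) + c / 2 * (norm (y - x))\<^sup>2)" for c :: real
    by (simp add: sum.distrib inner_sum_left)
  show "(\<Sum>i\<in>I. f i x) + (\<Sum>i\<in>I. g i x) \<bullet> (y - x) + of_nat (card I) * m / 2 * (norm (y - x))\<^sup>2 \<le> (\<Sum>i\<in>I. f i y)"
    unfolding * by (intro sum_mono quad_bounds_lower[OF assms])
  show "(\<Sum>i\<in>I. f i y) \<le> (\<Sum>i\<in>I. f i x) + (\<Sum>i\<in>I. g i x) \<bullet> (y - x) + of_nat (card I) * K / 2 * (norm (y - x))\<^sup>2"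
    unfolding * by (intro sum_mono quad_bounds_upper[OF assms])
qed

lemma quad_bounds_sum_fun:
  fixes f :: "'n::finite \<Rightarrow> real^'d \<Rightarrow> real"
  assumes "\<And>i. quad_bounds m K (f i) (g i)"
  shows "quad_bounds m K (sum_fun f) (\<lambda>X. \<chi> i. g i (X $ i))"
  unfolding quad_bounds_def
proof (intro allI conjI)
  fix X Y :: "(real^'d)^'n"
  have *: "sum_fun f X + (\<chi> i. g i (X $ i)) \<bullet> (Y - X) + c / 2 * (norm (Y - X))\<^sup>2
    = (\<Sum>i\<in>UNIV. f i (X $ i) + g i (X $ i) \<bullet> (Y $ i - X $ i) + c / 2 * (norm (Y $ i - X $ i))\<^sup>2)" for c
    unfolding power2_norm_eq_inner
    by (simp add: sum_fun_def inner_vec_def[where 'b = 'n] sum.distrib sum_distrib_left)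
  show "sum_fun f X + (\<chi> i. g i (X $ i)) \<bullet> (Y - X) + m / 2 * (norm (Y - X))\<^sup>2 \<le> sum_fun f Y"
    unfolding * sum_fun_def[of f Y] by (intro sum_mono quad_bounds_lower[OF assms])
  show "sum_fun f Y \<le> sum_fun f X + (\<chi> i. g i (X $ i)) \<bullet> (Y - X) + K / 2 * (norm (Y - X))\<^sup>2"
    unfolding * sum_fun_def[of f Y] by (intro sum_mono quad_bounds_upper[OF assms])
qed

lemma quad_bounds_add_quadratic:
  assumes q: "quad_bounds m K F g" and A: "psd_op A" and M: "\<And>x. x \<bullet> A x \<le> M * (norm x)\<^sup>2"
    and \<rho>: "0 \<le> \<rho>"
  shows "quad_bounds m (K + \<rho> * M) (\<lambda>x. F x + w \<bullet> x + \<rho> / 2 * (x \<bullet> A x)) (\<lambda>x. g x + w + \<rho> *\<^sub>R A x)"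
proof -
  have expand: "y \<bullet> A y = x \<bullet> A x + 2 * (A x \<bullet> (y - x)) + (y - x) \<bullet> A (y - x)" for x y
  proof -
    have "linear A" using A by (simp add: psd_op_def)
    then have "(y - x) \<bullet> A (y - x) = y \<bullet> A y - x \<bullet> A y - (y \<bullet> A x - x \<bullet> A x)"
      by (simp add: linear_diff inner_diff_left inner_diff_right)
    moreover have "A x \<bullet> (y - x) = A x \<bullet> y - A x \<bullet> x" by (rule inner_diff_right)
    moreover have "x \<bullet> A y = A x \<bullet> y" using A by (simp add: psd_op_def)
    ultimately show ?thesis
      using inner_commute[of y "A x"] inner_commute[of x "A x"] by linarith
  qed
  show ?thesis
    unfolding quad_bounds_def
  proof (intro allI conjI)
    fix x y
    have lo: "0 \<le> \<rho> / 2 * ((y - x) \<bullet> A (y - x))" using A \<rho> by (simp add: psd_op_def)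
    have hi: "\<rho> / 2 * ((y - x) \<bullet> A (y - x)) \<le> \<rho> / 2 * (M * (norm (y - x))\<^sup>2)"
      using M \<rho> by (intro mult_left_mono) auto
    have e: "\<rho> / 2 * (y \<bullet> A y) = \<rho> / 2 * (x \<bullet> A x) + \<rho> * (A x \<bullet> (y - x)) + \<rho> / 2 * ((y - x) \<bullet> A (y - x))"
      unfolding expand[of y x] by (simp only: distrib_left)
    have w: "w \<bullet> y = w \<bullet> x + w \<bullet> (y - x)" by (simp add: inner_diff_right)
    have i: "(g x + w + \<rho> *\<^sub>R A x) \<bullet> (y - x) = g x \<bullet> (y - x) + w \<bullet> (y - x) + \<rho> * (A x \<bullet> (y - x))"
      by (simp add: inner_add_left)
    show "F x + w \<bullet> x + \<rho> / 2 * (x \<bullet> A x) + (g x + w + \<rho> *\<^sub>R A x) \<bullet> (y - x) + m / 2 * (norm (y - x))\<^sup>2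
      \<le> F y + w \<bullet> y + \<rho> / 2 * (y \<bullet> A y)"
      unfolding e w i using quad_bounds_lower[OF q, of x y] lo by linarith
    have "(K + \<rho> * M) / 2 * (norm (y - x))\<^sup>2
      = K / 2 * (norm (y - x))\<^sup>2 + \<rho> / 2 * (M * (norm (y - x))\<^sup>2)"
      by (simp add: field_simps)
    then show "F y + w \<bullet> y + \<rho> / 2 * (y \<bullet> A y) \<le> F x + w \<bullet> x + \<rho> / 2 * (x \<bullet> A x)
      + (g x + w + \<rho> *\<^sub>R A x) \<bullet> (y - x) + (K + \<rho> * M) / 2 * (norm (y - x))\<^sup>2"
      unfolding e w i using quad_bounds_upper[OF q, of y x] hi by linarith
  qed
qed

section \<open>Accelerated gradient descent with inexact gradients\<close>

lemma norm_convex_combination_sq_le: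
  fixes p q :: "'a::real_inner"
  assumes "0 \<le> \<alpha>" "\<alpha> \<le> 1"
  shows "(norm ((1 - \<alpha>) *\<^sub>R p + \<alpha> *\<^sub>R q))\<^sup>2 \<le> (1 - \<alpha>) * (norm p)\<^sup>2 + \<alpha> * (norm q)\<^sup>2"
proof -
  have "(1 - \<alpha>) * (norm p)\<^sup>2 + \<alpha> * (norm q)\<^sup>2 - (norm ((1 - \<alpha>) *\<^sub>R p + \<alpha> *\<^sub>R q))\<^sup>2
    = \<alpha> * (1 - \<alpha>) * (norm (p - q))\<^sup>2"
    unfolding power2_norm_eq_inner
    by (simp add: inner_add_left inner_add_right inner_diff_left inner_diff_right
        inner_commute[of q p] algebra_simps power2_eq_square)
  moreover have "0 \<le> \<alpha> * (1 - \<alpha>) * (norm (p - q))\<^sup>2" using assms by simp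
  ultimately show ?thesis by linarith
qed

text \<open>One step of the method in terms of the potential \<open>G x - G s + m/2 \<parallel>z - s\<parallel>\<^sup>2\<close>. Add the descent
  inequality at \<open>y\<close> to the convex combination, with weights \<open>1 - \<alpha>\<close> and \<open>\<alpha>\<close>, of the lower bounds at
  \<open>x\<close> and \<open>s\<close>. The auxiliary point obeys \<open>z' = (1 - \<alpha>) z + \<alpha> y - (D + e) / (l \<alpha>)\<close>, and expanding
  \<open>\<parallel>z' - s\<parallel>\<^sup>2\<close> cancels all terms in the gradient because \<open>m = \<alpha>\<^sup>2 l\<close>. What remains of the error is
  \<open>\<alpha> e \<bullet> (s - z')\<close>.\<close>

lemma inexact_nesterov_step:
  fixes x y s x' z z' D e :: "'a::real_inner"
  assumes \<alpha>: "0 < \<alpha>" "\<alpha> \<le> 1" and l: "0 < l" and m: "m = \<alpha>\<^sup>2 * l"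
    and up: "Gx' \<le> Gy + D \<bullet> (x' - y) + l / 2 * (norm (x' - y))\<^sup>2"
    and lowx: "Gy + D \<bullet> (x - y) \<le> Gx"
    and lows: "Gy + D \<bullet> (s - y) + m / 2 * (norm (s - y))\<^sup>2 \<le> Gs"
    and x': "x' = y - (1 / l) *\<^sub>R (D + e)"
    and z: "z = y + (1 / \<alpha>) *\<^sub>R (y - x)"
    and z': "z' = x + (1 / \<alpha>) *\<^sub>R (x' - x)"
  shows "Gx' - Gs + m / 2 * (norm (z' - s))\<^sup>2
    \<le> (1 - \<alpha>) * (Gx - Gs + m / 2 * (norm (z - s))\<^sup>2) + \<alpha> * (e \<bullet> (s - z'))"
proof -
  define g where "g = D + e"
  define p where "p = z - s"
  define q where "q = y - s"
  define c where "c = (1 - \<alpha>) *\<^sub>R p + \<alpha> *\<^sub>R q"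
  have xp: "x - y = - (\<alpha> *\<^sub>R (p - q))" using \<alpha> by (simp add: p_def q_def z algebra_simps)
  have x'y: "x' - y = - ((1 / l) *\<^sub>R g)" by (simp add: x' g_def)
  have z'c: "z' - s = c - (1 / (l * \<alpha>)) *\<^sub>R g"
  proof -
    have "x' - x = (\<alpha> *\<^sub>R (p - q)) - (1 / l) *\<^sub>R g" using xp x'y by (simp add: algebra_simps)
    then have "z' = x + (1 / \<alpha>) *\<^sub>R ((\<alpha> *\<^sub>R (p - q)) - (1 / l) *\<^sub>R g)" by (simp add: z')
    also have "\<dots> = y - \<alpha> *\<^sub>R (p - q) + ((p - q) - (1 / (l * \<alpha>)) *\<^sub>R g)"
      using xp \<alpha> by (simp add: scaleR_diff_right mult.commute) (simp add: algebra_simps)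
    finally show ?thesis by (simp add: c_def q_def algebra_simps)
  qed
  have sq: "m / 2 * (norm (z' - s))\<^sup>2 = m / 2 * (norm c)\<^sup>2 - \<alpha> * (c \<bullet> g) + (norm g)\<^sup>2 / (2 * l)"
  proof -
    have "(norm (z' - s))\<^sup>2 = (norm c)\<^sup>2 - 2 / (l * \<alpha>) * (c \<bullet> g) + (norm g)\<^sup>2 / (l * \<alpha>)\<^sup>2"
      unfolding z'c power2_norm_eq_inner
      by (simp add: inner_diff_left inner_diff_right inner_commute[of g c] power2_eq_square
          diff_divide_distrib)
    then show ?thesis using \<alpha> l by (simp add: m field_simps power2_eq_square)
  qed
  have up': "Gx' \<le> Gy - (D \<bullet> g) / l + (norm g)\<^sup>2 / (2 * l)"
    using up l unfolding x'y by (simp add: power_divide power2_eq_square field_simps)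
  have "(1 - \<alpha>) * (Gy - \<alpha> * (D \<bullet> (p - q))) \<le> (1 - \<alpha>) * Gx"
    using lowx \<alpha> unfolding xp by (intro mult_left_mono) simp_all
  then have lowx': "(1 - \<alpha>) * Gy - (1 - \<alpha>) * \<alpha> * (D \<bullet> p) + (1 - \<alpha>) * \<alpha> * (D \<bullet> q) \<le> (1 - \<alpha>) * Gx"
    by (simp add: inner_diff_right algebra_simps)
  have "\<alpha> * (Gy - D \<bullet> q + m / 2 * (norm q)\<^sup>2) \<le> \<alpha> * Gs"
    using lows \<alpha> by (intro mult_left_mono) (simp_all add: q_def norm_minus_commute inner_diff_right)
  then have lows': "\<alpha> * Gy - \<alpha> * (D \<bullet> q) + \<alpha> * (m / 2 * (norm q)\<^sup>2) \<le> \<alpha> * Gs"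
    by (simp add: algebra_simps)
  have "m / 2 * (norm c)\<^sup>2 \<le> m / 2 * ((1 - \<alpha>) * (norm p)\<^sup>2 + \<alpha> * (norm q)\<^sup>2)"
    unfolding c_def using \<alpha> l by (intro mult_left_mono norm_convex_combination_sq_le) (auto simp: m)
  also have "\<dots> = (1 - \<alpha>) * (m / 2 * (norm p)\<^sup>2) + \<alpha> * (m / 2 * (norm q)\<^sup>2)"
    by (simp add: field_simps)
  finally have cvx: "m / 2 * (norm c)\<^sup>2 \<le> (1 - \<alpha>) * (m / 2 * (norm p)\<^sup>2) + \<alpha> * (m / 2 * (norm q)\<^sup>2)" .
  have err: "\<alpha> * (e \<bullet> (s - z')) = \<alpha> * (D \<bullet> c) - \<alpha> * (c \<bullet> g) - (D \<bullet> g) / l + (norm g)\<^sup>2 / l"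
  proof -
    have "s - z' = - (c - (1 / (l * \<alpha>)) *\<^sub>R g)" using z'c by (metis minus_diff_eq)
    moreover have "D - g = - e" by (simp add: g_def)
    ultimately have "e \<bullet> (s - z') = (D - g) \<bullet> (c - (1 / (l * \<alpha>)) *\<^sub>R g)"
      by (simp only: inner_minus_left inner_minus_right)
    also have "\<dots> = D \<bullet> c - c \<bullet> g - (D \<bullet> g) / (l * \<alpha>) + (norm g)\<^sup>2 / (l * \<alpha>)"
      by (simp add: inner_diff_left inner_diff_right power2_norm_eq_inner inner_commute[of g c]
          diff_divide_distrib)
    finally have "\<alpha> * (e \<bullet> (s - z'))
      = \<alpha> * (D \<bullet> c - c \<bullet> g - (D \<bullet> g) / (l * \<alpha>) + (norm g)\<^sup>2 / (l * \<alpha>))" by simp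
    also have "\<dots> = \<alpha> * (D \<bullet> c) - \<alpha> * (c \<bullet> g) - (D \<bullet> g) / l + (norm g)\<^sup>2 / l"
      using \<alpha>(1) l by (simp add: distrib_left right_diff_distrib)
    finally show ?thesis .
  qed
  have Dc: "\<alpha> * (D \<bullet> c) = (1 - \<alpha>) * \<alpha> * (D \<bullet> p) + \<alpha> * \<alpha> * (D \<bullet> q)"
    by (simp add: c_def inner_add_right algebra_simps)
  have "(1 - \<alpha>) * \<alpha> * (D \<bullet> q) = \<alpha> * (D \<bullet> q) - \<alpha> * \<alpha> * (D \<bullet> q)"
    "(1 - \<alpha>) * Gy = Gy - \<alpha> * Gy"
    "(1 - \<alpha>) * (Gx - Gs + m / 2 * (norm p)\<^sup>2) = (1 - \<alpha>) * Gx - Gs + \<alpha> * Gs + (1 - \<alpha>) * (m / 2 * (norm p)\<^sup>2)"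
    "(norm g)\<^sup>2 / l = (norm g)\<^sup>2 / (2 * l) + (norm g)\<^sup>2 / (2 * l)"
    using l by (simp_all add: algebra_simps)
  then show ?thesis
    unfolding sq err Dc p_def[symmetric] using up' lowx' lows' cvx by linarith
qed

text \<open>Young's inequality splits the error term into half of the new potential and a multiple of the
  squared gradient error: \<open>(1 - \<alpha>/2) V\<^sub>k\<^sub>+\<^sub>1 \<le> (1 - \<alpha>) V\<^sub>k + \<alpha>/2 r\<^sup>k \<Delta>\<close>. Since
  \<open>(1 - \<alpha>/2)\<^sup>2 = (1 - \<alpha>) + \<alpha>\<^sup>2/4\<close>, a bound \<open>V\<^sub>k \<le> M r\<^sup>k\<close> reproduces itself as soon as
  \<open>\<alpha>/2 \<Delta> \<le> \<alpha>\<^sup>2/4 M\<close>.\<close>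

lemma inexact_potential_decay:
  fixes V w E :: "nat \<Rightarrow> real"
  assumes \<alpha>: "0 < \<alpha>" "\<alpha> \<le> 1" and m: "0 < m" and \<Delta>: "0 \<le> \<Delta>" and r: "r = 1 - \<alpha> / 2"
    and init: "V 1 \<le> 2 * \<Delta>"
    and w: "\<And>k. 1 \<le> k \<Longrightarrow> m / 2 * (w (k + 1))\<^sup>2 \<le> V (k + 1)"
    and step: "\<And>k. 1 \<le> k \<Longrightarrow> V (k + 1) \<le> (1 - \<alpha>) * V k + \<alpha> * (E k * w (k + 1))"
    and E: "\<And>k. 1 \<le> k \<Longrightarrow> (E k)\<^sup>2 \<le> m / 2 * r ^ k * \<Delta>"
    and k: "1 \<le> k"
  shows "V k \<le> 4 * \<Delta> / \<alpha>\<^sup>2 * r ^ k"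
  using k
proof (induction k rule: nat_induct_at_least)
  case base
  have "\<alpha>\<^sup>2 \<le> 1" using \<alpha> by (simp add: power_le_one)
  then have "4 * \<Delta> \<le> 4 * \<Delta> / \<alpha>\<^sup>2" using \<alpha> \<Delta> by (simp add: pos_le_divide_eq mult_left_le)
  then have "4 * \<Delta> * (1 / 2) \<le> 4 * \<Delta> / \<alpha>\<^sup>2 * r"
    using \<alpha> \<Delta> r by (intro mult_mono) auto
  then show ?case using init by simp
next
  case (Suc k)
  define M where "M = 4 * \<Delta> / \<alpha>\<^sup>2"
  have r0: "0 < r" using r \<alpha> by simp
  have M: "\<alpha>\<^sup>2 * M = 4 * \<Delta>" using \<alpha> by (simp add: M_def)
  have "E k * w (k + 1) \<le> m / 4 * (w (k + 1))\<^sup>2 + (E k)\<^sup>2 / m"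
  proof -
    have "m / 4 * (w (k + 1))\<^sup>2 + (E k)\<^sup>2 / m - E k * w (k + 1) = (m / 2 * w (k + 1) - E k)\<^sup>2 / m"
      using m by (simp add: field_simps power2_eq_square)
    also have "\<dots> \<ge> 0" using m by simp
    finally show ?thesis by linarith
  qed
  also have "m / 4 * (w (k + 1))\<^sup>2 \<le> V (k + 1) / 2" using w[OF Suc.hyps] by simp
  also have "(E k)\<^sup>2 / m \<le> r ^ k * \<Delta> / 2"
    using E[OF Suc.hyps] m by (simp add: field_simps)
  finally have "\<alpha> * (E k * w (k + 1)) \<le> \<alpha> * (V (k + 1) / 2 + r ^ k * \<Delta> / 2)"
    using \<alpha> by (intro mult_left_mono) auto
  moreover have "(1 - \<alpha>) * V k \<le> (1 - \<alpha>) * (M * r ^ k)"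
    using Suc.IH \<alpha> by (intro mult_left_mono) (auto simp: M_def)
  moreover have "\<alpha> * (r ^ k * \<Delta>) \<le> \<alpha>\<^sup>2 / 2 * M * r ^ k"
  proof -
    have "\<alpha> * (r ^ k * \<Delta>) \<le> 1 * (r ^ k * \<Delta>)" using \<alpha> \<Delta> r0 by (intro mult_right_mono) auto
    also have "\<dots> \<le> 2 * \<Delta> * r ^ k" using \<Delta> r0 by simp
    also have "\<dots> = \<alpha>\<^sup>2 * M / 2 * r ^ k" by (simp add: M)
    finally show ?thesis by simp
  qed
  ultimately have "r * V (k + 1) \<le> (1 - \<alpha>) * (M * r ^ k) + \<alpha>\<^sup>2 / 4 * M * r ^ k"
    using step[OF Suc.hyps] unfolding r by (simp add: algebra_simps)
  also have "\<dots> = (1 - \<alpha> + \<alpha>\<^sup>2 / 4) * (M * r ^ k)" by (simp add: algebra_simps)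
  also have "1 - \<alpha> + \<alpha>\<^sup>2 / 4 = r * r" by (simp add: r power2_eq_square algebra_simps)
  also have "r * r * (M * r ^ k) = r * (M * r ^ (k + 1))" by simp
  finally have "V (k + 1) \<le> M * r ^ (k + 1)" using r0 by (rule mult_left_le_imp_le)
  then show ?case by (simp add: M_def)
qed

text \<open>Lower bounds are available only between points of the subspace \<open>V\<close>, which the iterates never
  leave. The point \<open>y\<^sub>k\<close> is a convex combination of \<open>x\<^sub>k\<close> and \<open>z\<^sub>k\<close>, and \<open>m/2\<close> times the
  squared distance of either from \<open>s\<close> is at most the potential; its initial value is at most \<open>2 \<Delta>\<close> because strong convexity
  bounds the distance term by the gap.\<close>

theorem inexact_nesterov_convergence:
  fixes G :: "'a::real_inner \<Rightarrow> real" and D :: "'a \<Rightarrow> 'a" and x y e :: "nat \<Rightarrow> 'a"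
  assumes V: "subspace V" and m: "0 < m" "m \<le> l"
    and low: "\<And>a b. a \<in> V \<Longrightarrow> b \<in> V \<Longrightarrow> G a + D a \<bullet> (b - a) + m / 2 * (norm (b - a))\<^sup>2 \<le> G b"
    and up: "\<And>a b. G b \<le> G a + D a \<bullet> (b - a) + l / 2 * (norm (b - a))\<^sup>2"
    and s: "s \<in> V" "D s = 0"
    and inV: "\<And>k. 1 \<le> k \<Longrightarrow> x k \<in> V" "\<And>k. 1 \<le> k \<Longrightarrow> y k \<in> V"
    and init: "x 1 = y 1"
    and xs: "\<And>k. 1 \<le> k \<Longrightarrow> x (k + 1) = y k - (1 / l) *\<^sub>R (D (y k) + e k)"
    and ys: "\<And>k. 1 \<le> k \<Longrightarrow> y (k + 1) = x (k + 1)
      + ((sqrt l - sqrt m) / (sqrt l + sqrt m)) *\<^sub>R (x (k + 1) - x k)"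
    and r: "r = 1 - 1 / 2 * sqrt (m / l)"
    and e: "\<And>k. 1 \<le> k \<Longrightarrow> (norm (e k))\<^sup>2 \<le> m / 2 * r ^ k * \<Delta>"
    and gap: "G (x 1) - G s \<le> \<Delta>"
    and k: "1 \<le> k"
  shows "(norm (y k - s))\<^sup>2 \<le> 8 * l / m\<^sup>2 * r ^ k * \<Delta>"
proof -
  define \<alpha> where "\<alpha> = sqrt (m / l)"
  have l: "0 < l" using m by simp
  have \<alpha>: "0 < \<alpha>" "\<alpha> \<le> 1" using m l by (auto simp: \<alpha>_def)
  have \<alpha>2: "\<alpha>\<^sup>2 = m / l" using m l by (simp add: \<alpha>_def)
  then have m\<alpha>: "m = \<alpha>\<^sup>2 * l" using l by simp
  have \<beta>: "(sqrt l - sqrt m) / (sqrt l + sqrt m) = (1 - \<alpha>) / (1 + \<alpha>)"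
  proof -
    have "sqrt m = \<alpha> * sqrt l" using l m by (simp add: \<alpha>_def real_sqrt_divide)
    then have "(sqrt l - sqrt m) / (sqrt l + sqrt m) = (sqrt l * (1 - \<alpha>)) / (sqrt l * (1 + \<alpha>))"
      by (simp add: algebra_simps)
    then show ?thesis using l by simp
  qed
  \<comment> \<open>This choice makes y the combination of x and z with weights proportional to 1 and \<alpha>.\<close>
  define z where "z k = y k + (1 / \<alpha>) *\<^sub>R (y k - x k)" for k
  define P where "P k = G (x k) - G s + m / 2 * (norm (z k - s))\<^sup>2" for k
  have growth: "m / 2 * (norm (x k - s))\<^sup>2 \<le> G (x k) - G s" if "1 \<le> k" for k
    using low[OF s(1) inV(1)[OF that]] s(2) by simp
  have zx: "z (k + 1) = x k + (1 / \<alpha>) *\<^sub>R (x (k + 1) - x k)" if "1 \<le> k" for k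
  proof -
    define d where "d = x (k + 1) - x k"
    have yd: "y (k + 1) = x (k + 1) + ((1 - \<alpha>) / (1 + \<alpha>)) *\<^sub>R d"
      using ys[OF that] by (simp add: \<beta> d_def)
    have "z (k + 1) = x (k + 1) + ((1 - \<alpha>) / (1 + \<alpha>) + (1 / \<alpha>) * ((1 - \<alpha>) / (1 + \<alpha>))) *\<^sub>R d"
      unfolding z_def yd by (simp add: scaleR_add_left)
    also have "(1 - \<alpha>) / (1 + \<alpha>) + (1 / \<alpha>) * ((1 - \<alpha>) / (1 + \<alpha>))
      = ((1 - \<alpha>) / (1 + \<alpha>)) * (1 + \<alpha>) / \<alpha>"
      using \<alpha>(1) by (simp only: distrib_left add_divide_distrib) simp
    also have "((1 - \<alpha>) / (1 + \<alpha>)) * (1 + \<alpha>) = 1 - \<alpha>" using \<alpha>(1) by simp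
    also have "(1 - \<alpha>) / \<alpha> = 1 / \<alpha> - 1" using \<alpha>(1) by (simp add: diff_divide_distrib)
    finally show ?thesis by (simp add: d_def algebra_simps)
  qed
  have P: "P k \<le> 4 * \<Delta> / \<alpha>\<^sup>2 * r ^ k" if "1 \<le> k" for k
  proof (rule inexact_potential_decay[where w = "\<lambda>k. norm (z k - s)" and E = "\<lambda>k. norm (e k)"
        and m = m, OF \<alpha> m(1)])
    have "0 \<le> m / 2 * (norm (x 1 - s))\<^sup>2" using m by simp
    then show "0 \<le> \<Delta>" using gap growth[of 1] by linarith
    show "r = 1 - \<alpha> / 2" by (simp add: r \<alpha>_def)
    have "z 1 = x 1" by (simp only: z_def init) simp
    then show "P 1 \<le> 2 * \<Delta>" using gap growth[of 1] by (simp add: P_def)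
  next
    fix k :: nat assume k: "1 \<le> k"
    have "0 \<le> m / 2 * (norm (x (k + 1) - s))\<^sup>2" using m by simp
    then show "m / 2 * (norm (z (k + 1) - s))\<^sup>2 \<le> P (k + 1)"
      using growth[of "k + 1"] by (simp add: P_def)
    have "P (k + 1) \<le> (1 - \<alpha>) * P k + \<alpha> * (e k \<bullet> (s - z (k + 1)))"
      unfolding P_def
    proof (rule inexact_nesterov_step[where x = "x k" and y = "y k", OF \<alpha> l m\<alpha> up _ low[OF inV(2)[OF k] s(1)] xs[OF k] z_def zx[OF k]])
      have "0 \<le> m / 2 * (norm (x k - y k))\<^sup>2" using m by simp
      then show "G (y k) + D (y k) \<bullet> (x k - y k) \<le> G (x k)"
        using low[OF inV(2)[OF k] inV(1)[OF k]] by linarith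
    qed
    also have "e k \<bullet> (s - z (k + 1)) \<le> norm (e k) * norm (z (k + 1) - s)"
      using norm_cauchy_schwarz[of "e k" "s - z (k + 1)"] by (simp add: norm_minus_commute)
    finally show "P (k + 1) \<le> (1 - \<alpha>) * P k + \<alpha> * (norm (e k) * norm (z (k + 1) - s))"
      using \<alpha> by simp
  qed (use e that in auto)
  have zP: "m / 2 * (norm (z k - s))\<^sup>2 \<le> P k" and xP: "m / 2 * (norm (x k - s))\<^sup>2 \<le> P k"
  proof -
    have "0 \<le> m / 2 * (norm (x k - s))\<^sup>2" "0 \<le> m / 2 * (norm (z k - s))\<^sup>2" using m by auto
    then show "m / 2 * (norm (z k - s))\<^sup>2 \<le> P k" "m / 2 * (norm (x k - s))\<^sup>2 \<le> P k"
      using growth[OF k] by (auto simp: P_def)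
  qed
  define \<theta> where "\<theta> = \<alpha> / (1 + \<alpha>)"
  have \<theta>: "0 \<le> \<theta>" "\<theta> \<le> 1" using \<alpha> by (auto simp: \<theta>_def field_simps)
  have "y k - s = (1 - \<theta>) *\<^sub>R (x k - s) + \<theta> *\<^sub>R (z k - s)"
  proof -
    have "(1 - \<theta>) *\<^sub>R (x k - s) + \<theta> *\<^sub>R (z k - s) = (x k - s) + (\<theta> * (1 + 1 / \<alpha>)) *\<^sub>R (y k - x k)"
      unfolding z_def by (simp add: algebra_simps)
    also have "1 + 1 / \<alpha> = (1 + \<alpha>) / \<alpha>" using \<alpha>(1) by (simp add: field_simps)
    also have "\<theta> * ((1 + \<alpha>) / \<alpha>) = 1" using \<alpha>(1) by (simp add: \<theta>_def)
    finally show ?thesis by simp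
  qed
  then have "m / 2 * (norm (y k - s))\<^sup>2 \<le> m / 2 * ((1 - \<theta>) * (norm (x k - s))\<^sup>2 + \<theta> * (norm (z k - s))\<^sup>2)"
    using norm_convex_combination_sq_le[OF \<theta>, of "x k - s" "z k - s"] m by simp
  also have "\<dots> = (1 - \<theta>) * (m / 2 * (norm (x k - s))\<^sup>2) + \<theta> * (m / 2 * (norm (z k - s))\<^sup>2)"
    by (simp add: field_simps)
  also have "\<dots> \<le> (1 - \<theta>) * P k + \<theta> * P k"
    using zP xP \<theta> by (intro add_mono mult_left_mono) auto
  also have "\<dots> = P k" by (simp add: algebra_simps)
  also have "\<dots> \<le> 4 * \<Delta> / \<alpha>\<^sup>2 * r ^ k" by (rule P[OF k])
  also have "\<dots> = 4 * \<Delta> * l / m * r ^ k" using l m by (simp add: \<alpha>2)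
  finally show ?thesis using m by (simp add: field_simps power2_eq_square)
qed

section \<open>The dual of a regularized problem with a linear constraint\<close>

lemma norm_add_sq:
  fixes x y :: "'a::real_inner"
  shows "(norm (x + y))\<^sup>2 = (norm x)\<^sup>2 + 2 * (x \<bullet> y) + (norm y)\<^sup>2"
  by (simp only: power2_norm_eq_inner) (simp add: inner_add_left inner_add_right inner_commute)

text \<open>The problem is to minimize \<open>F\<close> subject to \<open>S x = 0\<close>, and \<open>M a\<close> is the critical point, hence the
  minimizer, of the augmented Lagrangian \<open>F x + \<rho>/2 \<parallel>S x\<parallel>\<^sup>2 + a \<bullet> S x\<close>. The numbers \<open>lmin\<close> and
  \<open>lmax\<close> bound the nonzero spectrum of \<open>S \<circ> S\<close>.\<close>

locale augmented_dual =
  fixes F :: "'a::euclidean_space \<Rightarrow> real" and g S M :: "'a \<Rightarrow> 'a"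
    and \<mu> L \<rho> lmin lmax :: real
  assumes q: "quad_bounds \<mu> L F g"
    and S: "psd_op S"
    and top: "\<And>x. (norm (S x))\<^sup>2 \<le> lmax * (norm x)\<^sup>2"
    and gap: "\<And>x. \<exists>z. S z = S x \<and> lmin * (norm z)\<^sup>2 \<le> (norm (S z))\<^sup>2"
    and pos: "0 < \<mu>" "\<mu> \<le> L" "0 \<le> \<rho>" "0 < lmin" "lmin \<le> lmax"
    and M: "\<And>a. g (M a) + \<rho> *\<^sub>R S (S (M a)) + S a = 0"
begin

text \<open>The negated minimum of the augmented Lagrangian; it is a convex function, to be minimized.\<close>

definition dual :: "'a \<Rightarrow> real" where
  "dual a = - (F (M a) + \<rho> / 2 * (norm (S (M a)))\<^sup>2 + a \<bullet> S (M a))"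

definition L\<^sub>\<rho> :: real where "L\<^sub>\<rho> = lmax / (\<mu> + \<rho> * lmax)"

definition \<mu>\<^sub>\<rho> :: real where "\<mu>\<^sub>\<rho> = lmin / (L + \<rho> * lmin)"

lemma L_pos: "0 < L" and lmax_pos: "0 < lmax" and L\<^sub>\<rho>_pos: "0 < L\<^sub>\<rho>" and \<mu>\<^sub>\<rho>_pos: "0 < \<mu>\<^sub>\<rho>"
proof -
  show "0 < L" "0 < lmax" using pos by auto
  then show "0 < L\<^sub>\<rho>" "0 < \<mu>\<^sub>\<rho>"
    unfolding L\<^sub>\<rho>_def \<mu>\<^sub>\<rho>_def using pos by (auto intro!: divide_pos_pos add_pos_nonneg)
qed

lemma inverse_L\<^sub>\<rho>: "1 / L\<^sub>\<rho> = \<mu> / lmax + \<rho>"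
  using lmax_pos by (simp add: L\<^sub>\<rho>_def field_simps)

lemma inverse_\<mu>\<^sub>\<rho>: "1 / \<mu>\<^sub>\<rho> = L / lmin + \<rho>"
  using pos by (simp add: \<mu>\<^sub>\<rho>_def field_simps)

lemma \<mu>\<^sub>\<rho>_le_L\<^sub>\<rho>: "\<mu>\<^sub>\<rho> \<le> L\<^sub>\<rho>"
proof -
  have "\<mu> / lmax \<le> L / lmin" using pos by (intro frac_le) auto
  then have "1 / L\<^sub>\<rho> \<le> 1 / \<mu>\<^sub>\<rho>" by (simp add: inverse_L\<^sub>\<rho> inverse_\<mu>\<^sub>\<rho>)
  then show ?thesis using L\<^sub>\<rho>_pos \<mu>\<^sub>\<rho>_pos by (simp add: field_simps)
qed

lemma lin: "linear S" and sym: "S x \<bullet> y = x \<bullet> S y"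
  using S by (auto simp: psd_op_def)

lemma grad_M: "g (M a) \<bullet> d = - \<rho> * (S (M a) \<bullet> S d) - a \<bullet> S d"
proof -
  have "g (M a) = - (\<rho> *\<^sub>R S (S (M a)) + S a)"
    using M[of a] by (simp only: eq_neg_iff_add_eq_0 add.assoc)
  then show ?thesis by (simp add: inner_diff_left sym)
qed

lemma dual_ge: "- (F x + \<rho> / 2 * (norm (S x))\<^sup>2 + a \<bullet> S x) \<le> dual a"
proof -
  define d where "d = x - M a"
  have Sx: "S x = S (M a) + S d" by (simp add: d_def linear_diff[OF lin])
  have "F (M a) - \<rho> * (S (M a) \<bullet> S d) - a \<bullet> S d + \<mu> / 2 * (norm d)\<^sup>2 \<le> F x"
    using quad_bounds_lower[OF q, of "M a" x] unfolding d_def[symmetric] grad_M by simp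
  moreover have "0 \<le> \<mu> / 2 * (norm d)\<^sup>2" "0 \<le> \<rho> / 2 * (norm (S d))\<^sup>2" using pos by auto
  moreover have "\<rho> / 2 * (norm (S x))\<^sup>2
    = \<rho> / 2 * (norm (S (M a)))\<^sup>2 + \<rho> * (S (M a) \<bullet> S d) + \<rho> / 2 * (norm (S d))\<^sup>2"
    unfolding Sx norm_add_sq by (simp only: distrib_left)
  ultimately show ?thesis unfolding dual_def Sx[THEN arg_cong, of "inner a"] inner_add_right by linarith
qed

text \<open>The gradient of the dual is Lipschitz because \<open>M\<close> cannot move far: with \<open>d = M b - M a\<close>, strong
  convexity charges \<open>\<mu>/2 \<parallel>d\<parallel>\<^sup>2 + \<rho>/2 \<parallel>S d\<parallel>\<^sup>2 \<ge> K/2 \<parallel>S d\<parallel>\<^sup>2\<close> where \<open>K = \<mu>/lmax + \<rho> = 1/L\<^sub>\<rho>\<close>, and the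
  gain \<open>(b - a) \<bullet> S d\<close> is absorbed by completing the square.\<close>

lemma dual_upper: "dual b \<le> dual a + - S (M a) \<bullet> (b - a) + L\<^sub>\<rho> / 2 * (norm (b - a))\<^sup>2"
proof -
  define d where "d = M b - M a"
  define u where "u = b - a"
  define K where "K = \<mu> / lmax + \<rho>"
  have K: "0 < K" "L\<^sub>\<rho> = 1 / K"
    unfolding K_def inverse_L\<^sub>\<rho>[symmetric] using L\<^sub>\<rho>_pos by simp_all
  have SMb: "S (M b) = S (M a) + S d" by (simp add: d_def linear_diff[OF lin])
  have F: "F (M a) - \<rho> * (S (M a) \<bullet> S d) - a \<bullet> S d + \<mu> / 2 * (norm d)\<^sup>2 \<le> F (M b)"
    using quad_bounds_lower[OF q, of "M a" "M b"] unfolding d_def[symmetric] grad_M by simp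
  have "\<mu> / lmax * (norm (S d))\<^sup>2 \<le> \<mu> / lmax * (lmax * (norm d)\<^sup>2)"
    using top[of d] pos lmax_pos by (intro mult_left_mono) auto
  then have T: "\<mu> / lmax * (norm (S d))\<^sup>2 / 2 \<le> \<mu> / 2 * (norm d)\<^sup>2" using lmax_pos by simp
  have R: "\<rho> / 2 * (norm (S (M b)))\<^sup>2
    = \<rho> / 2 * (norm (S (M a)))\<^sup>2 + \<rho> * (S (M a) \<bullet> S d) + \<rho> * (norm (S d))\<^sup>2 / 2"
    unfolding SMb norm_add_sq by (simp only: distrib_left)
  have I: "b \<bullet> S (M b) = a \<bullet> S (M a) + a \<bullet> S d + u \<bullet> S (M a) + u \<bullet> S d"
    unfolding SMb u_def by (simp add: inner_add_right inner_diff_left)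
  have "0 \<le> (norm (u + K *\<^sub>R S d))\<^sup>2 / (2 * K)" using K by simp
  also have "\<dots> = (norm u)\<^sup>2 / (2 * K) + u \<bullet> S d + K * (norm (S d))\<^sup>2 / 2"
    unfolding norm_add_sq using K by (simp add: field_simps power2_eq_square)
  finally have Q: "0 \<le> L\<^sub>\<rho> / 2 * (norm u)\<^sup>2 + u \<bullet> S d + \<mu> / lmax * (norm (S d))\<^sup>2 / 2 + \<rho> * (norm (S d))\<^sup>2 / 2"
    by (simp add: K K_def algebra_simps add_divide_distrib)
  have "- S (M a) \<bullet> (b - a) = - (u \<bullet> S (M a))" by (simp add: u_def inner_commute)
  then show ?thesis
    unfolding dual_def u_def[symmetric] using F T R I Q by linarith
qed

text \<open>Evaluate the augmented Lagrangian for \<open>b\<close> at the test point \<open>M a - t z\<close> with \<open>S z = b - a\<close>, where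
  \<open>z\<close> has no kernel component, so that \<open>lmin \<parallel>z\<parallel>\<^sup>2 \<le> \<parallel>b - a\<parallel>\<^sup>2\<close>. The result is a quadratic in \<open>t\<close>
  that is optimal at \<open>t = \<mu>\<^sub>\<rho>\<close>. Directions outside the range of \<open>S\<close> have no such \<open>z\<close>: the dual is
  constant along the kernel.\<close>

lemma dual_lower:
  assumes "b - a \<in> range S"
  shows "dual a + - S (M a) \<bullet> (b - a) + \<mu>\<^sub>\<rho> / 2 * (norm (b - a))\<^sup>2 \<le> dual b"
proof -
  define u where "u = b - a"
  from assms gap obtain z where z: "S z = u" "lmin * (norm z)\<^sup>2 \<le> (norm u)\<^sup>2"
    unfolding u_def by (metis imageE)
  define t where "t = \<mu>\<^sub>\<rho>"
  define x where "x = M a - t *\<^sub>R z"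
  have Sx: "S x = S (M a) + - (t *\<^sub>R u)" by (simp add: x_def linear_diff[OF lin] linear_scale[OF lin] z(1))
  have F: "F x \<le> F (M a) + t * \<rho> * (S (M a) \<bullet> u) + t * (a \<bullet> u) + L / 2 * (t\<^sup>2 * (norm z)\<^sup>2)"
    using quad_bounds_upper[OF q, of x "M a"] unfolding grad_M
    by (simp add: x_def linear_scale[OF lin] linear_neg[OF lin] z(1) power_mult_distrib algebra_simps)
  have R: "\<rho> / 2 * (norm (S x))\<^sup>2
    = \<rho> / 2 * (norm (S (M a)))\<^sup>2 - t * \<rho> * (S (M a) \<bullet> u) + \<rho> / 2 * (t\<^sup>2 * (norm u)\<^sup>2)"
    unfolding Sx norm_add_sq by (simp add: power_mult_distrib algebra_simps)
  have I: "b \<bullet> S x = a \<bullet> S (M a) + u \<bullet> S (M a) - t * (a \<bullet> u) - t * (norm u)\<^sup>2"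
    unfolding Sx power2_norm_eq_inner
    by (simp add: u_def inner_diff_left inner_diff_right algebra_simps)
  have "L / 2 * (t\<^sup>2 * (norm z)\<^sup>2) \<le> L / 2 * (t\<^sup>2 * ((norm u)\<^sup>2 / lmin))"
    using z(2) pos L_pos by (intro mult_left_mono) (auto simp: field_simps)
  then have "L / 2 * (t\<^sup>2 * (norm z)\<^sup>2) + \<rho> / 2 * (t\<^sup>2 * (norm u)\<^sup>2) \<le> (L / lmin + \<rho>) * t\<^sup>2 / 2 * (norm u)\<^sup>2"
    by (simp add: algebra_simps add_divide_distrib)
  also have "\<dots> = t / 2 * (norm u)\<^sup>2"
    using \<mu>\<^sub>\<rho>_pos by (simp add: inverse_\<mu>\<^sub>\<rho>[symmetric] t_def power2_eq_square)
  finally have Q: "L / 2 * (t\<^sup>2 * (norm z)\<^sup>2) + \<rho> / 2 * (t\<^sup>2 * (norm u)\<^sup>2) \<le> t / 2 * (norm u)\<^sup>2" .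
  have "- S (M a) \<bullet> (b - a) = - (u \<bullet> S (M a))" by (simp add: u_def inner_commute)
  moreover have "t / 2 * (norm u)\<^sup>2 = t * (norm u)\<^sup>2 - t / 2 * (norm u)\<^sup>2" by simp
  ultimately show ?thesis
    unfolding u_def[symmetric] t_def[symmetric] dual_def[of a] using dual_ge[of x b] F R I Q
    by linarith
qed

text \<open>Strong monotonicity of the gradient: adding the lower bounds for \<open>F\<close> at \<open>M a\<close> and \<open>M b\<close> gives
  \<open>\<mu> \<parallel>d\<parallel>\<^sup>2 \<le> \<parallel>a - b\<parallel> \<parallel>S d\<parallel>\<close> with \<open>d = M a - M b\<close>, and \<open>\<parallel>S d\<parallel>\<^sup>2 \<le> lmax \<parallel>d\<parallel>\<^sup>2\<close>.\<close>

lemma primal_lipschitz: "(norm (M a - M b))\<^sup>2 \<le> lmax / \<mu>\<^sup>2 * (norm (a - b))\<^sup>2"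
proof -
  define d where "d = M a - M b"
  have Sd: "S (M a) = S (M b) + S d" "S (M b - M a) = - S d"
    by (simp_all add: d_def linear_diff[OF lin])
  have n: "norm (M b - M a) = norm d" by (simp add: d_def norm_minus_commute)
  have "F (M a) + \<rho> * (S (M a) \<bullet> S d) + a \<bullet> S d + \<mu> / 2 * (norm d)\<^sup>2 \<le> F (M b)"
    using quad_bounds_lower[OF q, of "M a" "M b"] unfolding grad_M n Sd(2) by simp
  moreover have "F (M b) - \<rho> * (S (M b) \<bullet> S d) - b \<bullet> S d + \<mu> / 2 * (norm d)\<^sup>2 \<le> F (M a)"
    using quad_bounds_lower[OF q, of "M b" "M a"] unfolding d_def[symmetric] grad_M by simp
  moreover have "\<rho> * (S (M a) \<bullet> S d) = \<rho> * (S (M b) \<bullet> S d) + \<rho> * (norm (S d))\<^sup>2"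
    unfolding Sd(1) power2_norm_eq_inner by (simp add: inner_add_left algebra_simps)
  moreover have "0 \<le> \<rho> * (norm (S d))\<^sup>2" using pos by simp
  moreover have "- ((a - b) \<bullet> S d) \<le> norm (a - b) * norm (S d)"
    using Cauchy_Schwarz_ineq2[of "a - b" "S d"] by linarith
  ultimately have "\<mu> * (norm d)\<^sup>2 \<le> norm (a - b) * norm (S d)"
    by (simp add: inner_diff_left)
  then have "(\<mu> * (norm d)\<^sup>2)\<^sup>2 \<le> (norm (a - b) * norm (S d))\<^sup>2"
    using pos by (intro power_mono) auto
  also have "\<dots> \<le> (norm (a - b))\<^sup>2 * (lmax * (norm d)\<^sup>2)"
    unfolding power_mult_distrib using top[of d] by (intro mult_left_mono) auto
  finally have *: "(norm d)\<^sup>2 * (\<mu>\<^sup>2 * (norm d)\<^sup>2) \<le> (norm d)\<^sup>2 * (lmax * (norm (a - b))\<^sup>2)"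
    by (simp add: power2_eq_square mult_ac)
  have "\<mu>\<^sup>2 * (norm d)\<^sup>2 \<le> lmax * (norm (a - b))\<^sup>2"
  proof (cases "d = 0")
    case False
    then have "0 < (norm d)\<^sup>2" by simp
    with * show ?thesis by (rule mult_left_le_imp_le)
  qed (use lmax_pos in simp)
  then show ?thesis using pos by (simp add: d_def field_simps)
qed

lemma M_unique:
  assumes "g x + \<rho> *\<^sub>R S (S x) + S a = 0"
  shows "M a = x"
proof -
  define d where "d = x - M a"
  have gx: "g x = - (\<rho> *\<^sub>R S (S x) + S a)"
    using assms by (simp only: eq_neg_iff_add_eq_0 add.assoc)
  have "g x \<bullet> (M a - x) = \<rho> * (S x \<bullet> S d) + a \<bullet> S d"
  proof -
    have "M a - x = - d" by (simp add: d_def)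
    then show ?thesis unfolding gx by (simp add: inner_diff_left sym linear_neg[OF lin])
  qed
  then have "F x + \<rho> * (S x \<bullet> S d) + a \<bullet> S d + \<mu> / 2 * (norm d)\<^sup>2 \<le> F (M a)"
    using quad_bounds_lower[OF q, of x "M a"] by (simp add: d_def norm_minus_commute)
  moreover have "F (M a) - \<rho> * (S (M a) \<bullet> S d) - a \<bullet> S d + \<mu> / 2 * (norm d)\<^sup>2 \<le> F x"
    using quad_bounds_lower[OF q, of "M a" x] unfolding d_def[symmetric] grad_M by simp
  moreover have "\<rho> * (S x \<bullet> S d) = \<rho> * (S (M a) \<bullet> S d) + \<rho> * (norm (S d))\<^sup>2"
    unfolding power2_norm_eq_inner
    by (simp add: d_def linear_diff[OF lin] inner_diff_left algebra_simps)
  moreover have "0 \<le> \<rho> * (norm (S d))\<^sup>2" using pos by simp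
  ultimately have "\<mu> * (norm d)\<^sup>2 \<le> 0" by simp
  then have "d = 0" using pos by (simp add: mult_le_0_iff)
  then show ?thesis by (simp add: d_def)
qed

text \<open>The hypotheses on \<open>Xs\<close> and \<open>s\<close> are the optimality conditions: \<open>Xs\<close> is feasible and \<open>s\<close> is a
  Lagrange multiplier for it, so \<open>M s = Xs\<close>. The dual gap at 0 is at most \<open>\<Delta>\<close> since adding the
  regularizer only raises the minimum of \<open>F\<close>. The triangle inequality through \<open>M (y\<^sub>k)\<close> gives
  \<open>2 * 1/2 + 2 * 8 = 17\<close>.\<close>

theorem convergence:
  fixes u y X :: "nat \<Rightarrow> 'a"
  assumes opt: "S Xs = 0" "g Xs = - S s" "s \<in> range S"
    and init: "u 1 = 0" "y 1 = 0"
    and us: "\<And>k. 1 \<le> k \<Longrightarrow> u (k + 1) = y k + (1 / L\<^sub>\<rho>) *\<^sub>R S (X k)"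
    and ys: "\<And>k. 1 \<le> k \<Longrightarrow> y (k + 1) = u (k + 1)
      + ((sqrt L\<^sub>\<rho> - sqrt \<mu>\<^sub>\<rho>) / (sqrt L\<^sub>\<rho> + sqrt \<mu>\<^sub>\<rho>)) *\<^sub>R (u (k + 1) - u k)"
    and r: "r = 1 - 1 / 2 * sqrt (\<mu>\<^sub>\<rho> / L\<^sub>\<rho>)"
    and acc: "\<And>k. 1 \<le> k \<Longrightarrow> (norm (X k - M (y k)))\<^sup>2 \<le> \<mu>\<^sub>\<rho> / (2 * lmax) * r ^ k * \<Delta>"
    and \<Delta>: "\<And>x. F Xs - F x \<le> \<Delta>"
    and k: "1 \<le> k"
  shows "(norm (X k - Xs))\<^sup>2 \<le> 17 * (L\<^sub>\<rho> * lmax / (\<mu>\<^sup>2 * \<mu>\<^sub>\<rho>\<^sup>2)) * r ^ k * \<Delta>"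
proof -
  have Ms: "M s = Xs"
    by (rule M_unique) (simp add: opt linear_0[OF lin])
  have subV: "subspace (range S)" using lin by (simp add: linear_subspace_image)
  have inV: "u j \<in> range S \<and> y j \<in> range S" if "1 \<le> j" for j
    using that
  proof (induction j rule: nat_induct_at_least)
    case base
    have "0 \<in> range S" using subV by (rule subspace_0)
    then show ?case using init by simp
  next
    case (Suc j)
    then have "u (j + 1) \<in> range S"
      unfolding us[OF Suc.hyps] using subV by (intro subspace_add subspace_scale) auto
    moreover from this have "y (j + 1) \<in> range S"
      unfolding ys[OF Suc.hyps] using subV Suc.IH by (intro subspace_add subspace_scale subspace_diff) auto
    ultimately show ?case by simp
  qed
  have r0: "0 \<le> r"
  proof -
    have "sqrt (\<mu>\<^sub>\<rho> / L\<^sub>\<rho>) \<le> 1" using \<mu>\<^sub>\<rho>_le_L\<^sub>\<rho> L\<^sub>\<rho>_pos by simp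
    then show ?thesis unfolding r by linarith
  qed
  have \<Delta>0: "0 \<le> \<Delta>" using \<Delta>[of Xs] by simp
  have dual_gap0: "dual 0 - dual s \<le> \<Delta>"
  proof -
    have "dual s = - F Xs" by (simp add: dual_def Ms opt linear_0[OF lin])
    moreover have "0 \<le> \<rho> / 2 * (norm (S (M 0)))\<^sup>2" using pos by simp
    ultimately show ?thesis using \<Delta>[of "M 0"] by (simp add: dual_def)
  qed
  have y: "(norm (y k - s))\<^sup>2 \<le> 8 * L\<^sub>\<rho> / \<mu>\<^sub>\<rho>\<^sup>2 * r ^ k * \<Delta>"
  proof (rule inexact_nesterov_convergence[where G = dual and D = "\<lambda>a. - S (M a)" and x = u
        and e = "\<lambda>k. - S (X k - M (y k))", OF subV \<mu>\<^sub>\<rho>_pos \<mu>\<^sub>\<rho>_le_L\<^sub>\<rho> _ dual_upper opt(3) _ _ _ _ _ ys r])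
    show "dual a + - S (M a) \<bullet> (b - a) + \<mu>\<^sub>\<rho> / 2 * (norm (b - a))\<^sup>2 \<le> dual b"
      if "a \<in> range S" "b \<in> range S" for a b
      using dual_lower subspace_diff[OF subV that(2,1)] by blast
    show "- S (M s) = 0" by (simp add: Ms opt)
    show "u j \<in> range S" "y j \<in> range S" if "1 \<le> j" for j using inV[OF that] by auto
    show "u 1 = y 1" using init by simp
    show "u (j + 1) = y j - (1 / L\<^sub>\<rho>) *\<^sub>R (- S (M (y j)) + - S (X j - M (y j)))" if "1 \<le> j" for j
      using us[OF that] by (simp add: linear_diff[OF lin])
    show "(norm (- S (X j - M (y j))))\<^sup>2 \<le> \<mu>\<^sub>\<rho> / 2 * r ^ j * \<Delta>" if "1 \<le> j" for j
    proof -
      have "(norm (S (X j - M (y j))))\<^sup>2 \<le> lmax * (norm (X j - M (y j)))\<^sup>2" by (rule top)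
      also have "\<dots> \<le> lmax * (\<mu>\<^sub>\<rho> / (2 * lmax) * r ^ j * \<Delta>)"
        using acc[OF that] lmax_pos by (intro mult_left_mono) auto
      finally show ?thesis using lmax_pos by simp
    qed
    show "dual (u 1) - dual s \<le> \<Delta>" using dual_gap0 init by simp
  qed (use k in auto)
  define unit where "unit = L\<^sub>\<rho> * lmax / (\<mu>\<^sup>2 * \<mu>\<^sub>\<rho>\<^sup>2)"
  define d where "d = r ^ k * \<Delta>"
  have d0: "0 \<le> d" using r0 \<Delta>0 by (simp add: d_def)
  have "(norm (M (y k) - Xs))\<^sup>2 \<le> lmax / \<mu>\<^sup>2 * (norm (y k - s))\<^sup>2"
    using primal_lipschitz[of "y k" s] by (simp add: Ms)
  also have "\<dots> \<le> lmax / \<mu>\<^sup>2 * (8 * L\<^sub>\<rho> / \<mu>\<^sub>\<rho>\<^sup>2 * r ^ k * \<Delta>)"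
    using y lmax_pos by (intro mult_left_mono) auto
  also have "\<dots> = 8 * unit * d" by (simp add: unit_def d_def)
  finally have A: "(norm (M (y k) - Xs))\<^sup>2 \<le> 8 * unit * d" .
  have "\<mu>\<^sub>\<rho> / lmax \<le> unit"
  proof -
    have "L\<^sub>\<rho> \<le> lmax / \<mu>"
      unfolding L\<^sub>\<rho>_def using pos lmax_pos by (intro divide_left_mono) (auto intro!: mult_pos_pos add_pos_nonneg)
    then have "\<mu> * \<mu>\<^sub>\<rho> \<le> lmax"
      using \<mu>\<^sub>\<rho>_le_L\<^sub>\<rho> pos by (simp add: pos_le_divide_eq mult.commute) (smt (verit) mult_left_mono)
    then have "(\<mu> * \<mu>\<^sub>\<rho>)\<^sup>2 \<le> lmax\<^sup>2" using pos \<mu>\<^sub>\<rho>_pos by (intro power_mono) auto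
    then have "\<mu>\<^sub>\<rho> * (\<mu> * \<mu>\<^sub>\<rho>)\<^sup>2 \<le> L\<^sub>\<rho> * lmax\<^sup>2"
      using \<mu>\<^sub>\<rho>_le_L\<^sub>\<rho> \<mu>\<^sub>\<rho>_pos by (intro mult_mono) auto
    then show ?thesis
      unfolding unit_def using pos lmax_pos \<mu>\<^sub>\<rho>_pos by (simp add: field_simps power2_eq_square)
  qed
  then have "\<mu>\<^sub>\<rho> / lmax * d \<le> unit * d" using d0 by (rule mult_right_mono)
  have B: "(norm (X k - M (y k)))\<^sup>2 \<le> unit * d / 2"
  proof -
    note acc[OF k]
    also have "\<mu>\<^sub>\<rho> / (2 * lmax) * r ^ k * \<Delta> = \<mu>\<^sub>\<rho> / lmax * d / 2" by (simp add: d_def)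
    also have "\<dots> \<le> unit * d / 2"
      using \<open>\<mu>\<^sub>\<rho> / lmax * d \<le> unit * d\<close> by (rule divide_right_mono) simp
    finally show ?thesis .
  qed
  have "(norm (X k - Xs))\<^sup>2 \<le> 2 * (norm (X k - M (y k)))\<^sup>2 + 2 * (norm (M (y k) - Xs))\<^sup>2"
  proof -
    have "X k - Xs = (X k - M (y k)) + (M (y k) - Xs)" by simp
    then have "(norm (X k - Xs))\<^sup>2 \<le> (norm (X k - M (y k)) + norm (M (y k) - Xs))\<^sup>2"
      by (metis norm_ge_zero norm_triangle_ineq power_mono)
    also have "\<dots> \<le> 2 * (norm (X k - M (y k)))\<^sup>2 + 2 * (norm (M (y k) - Xs))\<^sup>2"
      using sum_squares_bound[of "norm (X k - M (y k))" "norm (M (y k) - Xs)"] by (simp add: power2_sum)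
    finally show ?thesis .
  qed
  also have "\<dots> \<le> 17 * unit * d" using A B by simp
  finally show ?thesis by (simp add: unit_def d_def)
qed

end

section \<open>Mixing matrices and the decentralized problem\<close>

text \<open>Fixing the coordinate \<open>c\<close> in every block turns the Kronecker product into \<open>W\<close> itself, so
  statements about it reduce to statements about \<open>W\<close> slice by slice.\<close>

definition slice :: "'d \<Rightarrow> (real^'d)^'n \<Rightarrow> real^'n" where
  "slice c X = (\<chi> i. X $ i $ c)"

lemma slice_kron_id: "slice c (kron_id W X) = W *v slice c X"
  by (simp add: slice_def kron_id_def matrix_vector_mult_def vec_eq_iff)

lemma inner_eq_sum_slices: "X \<bullet> Y = (\<Sum>c\<in>UNIV. slice c X \<bullet> slice c Y)"
  by (simp add: slice_def inner_vec_def) (rule sum.swap)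

lemma eq_iff_slices_eq: "X = Y \<longleftrightarrow> (\<forall>c. slice c X = slice c Y)"
  by (auto simp: slice_def vec_eq_iff)

lemma mixing_matrix_selfadjoint:
  assumes "mixing_matrix E W"
  shows "selfadjoint ((*v) W)"
proof -
  have "transpose W = W" using assms by (simp add: mixing_matrix_def)
  then have "(W *v x) \<bullet> y = x \<bullet> (W *v y)" for x y
    by (metis dot_lmul_matrix transpose_matrix_vector)
  then show ?thesis by (simp add: selfadjoint_def)
qed

lemma psd_op_kron_id:
  fixes W :: "real^'n^'n"
  assumes "mixing_matrix E W"
  shows "psd_op (kron_id W :: (real^'d)^'n \<Rightarrow> (real^'d)^'n)"
  unfolding psd_op_def
proof (intro conjI allI)
  show "linear (kron_id W :: (real^'d)^'n \<Rightarrow> (real^'d)^'n)"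
    by (rule linearI) (simp_all add: kron_id_def vec_eq_iff sum.distrib sum_distrib_left algebra_simps)
  fix X Y :: "(real^'d)^'n"
  show "kron_id W X \<bullet> Y = X \<bullet> kron_id W Y"
    using mixing_matrix_selfadjoint[OF assms]
    by (simp add: inner_eq_sum_slices slice_kron_id selfadjoint_def)
  show "0 \<le> X \<bullet> kron_id W X"
    using assms by (simp add: inner_eq_sum_slices slice_kron_id mixing_matrix_def sum_nonneg)
qed

text \<open>Some slice of an eigenvector is nonzero, and it is an eigenvector of \<open>W\<close>.\<close>

lemma op_eigenvalues_kron_id:
  fixes W :: "real^'n^'n"
  shows "op_eigenvalues (kron_id W :: (real^'d)^'n \<Rightarrow> (real^'d)^'n) \<subseteq> eigenvalues W"
proof
  fix l assume "l \<in> op_eigenvalues (kron_id W :: (real^'d)^'n \<Rightarrow> (real^'d)^'n)"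
  then obtain X :: "(real^'d)^'n" where X: "X \<noteq> 0" "kron_id W X = l *\<^sub>R X"
    by (auto simp: op_eigenvalues_def)
  obtain c where c: "slice c X \<noteq> slice c 0" using X(1) eq_iff_slices_eq by blast
  have "W *v slice c X = slice c (l *\<^sub>R X)" by (simp only: slice_kron_id[symmetric] X(2))
  also have "\<dots> = l *\<^sub>R slice c X" by (simp add: slice_def vec_eq_iff)
  finally show "l \<in> eigenvalues W"
    using c by (auto simp: eigenvalues_def slice_def vec_eq_iff intro!: exI[of _ "slice c X"])
qed

lemma kron_id_consensus:
  fixes W :: "real^'n^'n"
  assumes "mixing_matrix E W"
  shows "kron_id W (\<chi> i. x) = 0"
proof -
  have "{v. W *v v = 0} = span {1 :: real^'n}" using assms by (simp add: mixing_matrix_def)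
  then have "(1 :: real^'n) \<in> {v. W *v v = 0}" by (simp only: span_base insertI1)
  then have "W *v (a *\<^sub>R 1) = 0" for a by (simp add: matrix_vector_mult_scaleR)
  moreover have "slice c (\<chi> i. x) = (x $ c) *\<^sub>R (1 :: real^'n)" "slice c 0 = (0 :: real^'n)" for c
    by (simp_all add: slice_def vec_eq_iff)
  ultimately show ?thesis unfolding eq_iff_slices_eq slice_kron_id by simp
qed

lemma kron_id_kernel_consensus:
  assumes "mixing_matrix E W" "kron_id W X = 0"
  shows "X $ i = X $ j"
proof -
  have "slice c X $ i = slice c X $ j" for c
  proof -
    have "W *v slice c X = slice c 0" by (simp only: slice_kron_id[symmetric] assms(2))
    then have "slice c X \<in> {v. W *v v = 0}" by (simp add: slice_def vec_eq_iff)
    moreover have "{v. W *v v = 0} = span {1}" using assms(1) by (simp add: mixing_matrix_def)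
    ultimately have "slice c X \<in> span {1}" by blast
    then obtain a where "slice c X = a *\<^sub>R 1" by (auto simp: span_singleton)
    then show ?thesis by simp
  qed
  then show ?thesis by (simp add: slice_def vec_eq_iff)
qed

lemma eigenvalues_mixing_matrix:
  assumes "mixing_matrix E W"
  shows "finite (eigenvalues W)" "eigenvalues W \<noteq> {}"
proof -
  have "eigenvalues W = op_eigenvalues ((*v) W)" by (simp add: eigenvalues_def op_eigenvalues_def)
  then show "finite (eigenvalues W)" "eigenvalues W \<noteq> {}"
    using finite_op_eigenvalues op_eigenvalues_nonempty mixing_matrix_selfadjoint[OF assms] by auto
qed

lemma eigenvalue_mixing_matrix_nonneg:
  assumes "mixing_matrix E W" "l \<in> eigenvalues W"
  shows "0 \<le> l"
proof -
  obtain v where v: "v \<noteq> 0" "W *v v = l *\<^sub>R v" using assms(2) by (auto simp: eigenvalues_def)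
  have "0 \<le> v \<bullet> (W *v v)" using assms(1) by (simp add: mixing_matrix_def)
  moreover have "0 < v \<bullet> v" using v(1) by simp
  ultimately show ?thesis using v(2) by (simp add: zero_le_mult_iff)
qed

lemma psd_sqrt_inner:
  fixes A :: "'a::euclidean_space \<Rightarrow> 'a"
  assumes "psd_op A"
  shows "(norm (psd_sqrt A x))\<^sup>2 = x \<bullet> A x"
proof -
  have "(norm (psd_sqrt A x))\<^sup>2 = psd_sqrt A x \<bullet> psd_sqrt A x" by (rule power2_norm_eq_inner)
  also have "\<dots> = x \<bullet> psd_sqrt A (psd_sqrt A x)"
    using psd_sqrt(1)[OF assms] unfolding psd_op_def by blast
  finally show ?thesis by (simp only: psd_sqrt(2)[OF assms])
qed

text \<open>Strong duality for the unregularized problem. Weak duality is the Fenchel inequality at \<open>Xs\<close>,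
  where \<open>\<surd>A Xs = 0\<close> removes the linear term; the multiplier \<open>s\<close> attains it because
  \<open>- \<surd>A s\<close> is the gradient at \<open>Xs\<close>.\<close>

lemma dual_gap_eq:
  fixes f :: "'n::finite \<Rightarrow> real^'d \<Rightarrow> real"
  assumes q: "quad_bounds \<mu> L (sum_fun f) g" and \<mu>: "0 < \<mu>" and A: "psd_op (kron_id W :: (real^'d)^'n \<Rightarrow> _)"
    and opt: "psd_sqrt (kron_id W) Xs = 0" "g Xs = - psd_sqrt (kron_id W) s" and X0: "g X0 = 0"
  shows "dual_gap W f = sum_fun f Xs - sum_fun f X0"
proof -
  have sym: "psd_sqrt (kron_id W) Y \<bullet> Xs = 0" for Y
    using psd_sqrt(1)[OF A] opt(1) by (simp add: psd_op_def)
  have "(LEAST v. v \<in> range (\<lambda>\<Lambda>. convex_conjugate (sum_fun f) (- psd_sqrt (kron_id W) \<Lambda>)))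
    = - sum_fun f Xs"
  proof (rule Least_equality)
    have "convex_conjugate (sum_fun f) (- psd_sqrt (kron_id W) s) = - sum_fun f Xs"
      using conjugate_at_gradient[OF q, of Xs] \<mu> by (simp add: opt(2) sym)
    then show "- sum_fun f Xs \<in> range (\<lambda>\<Lambda>. convex_conjugate (sum_fun f) (- psd_sqrt (kron_id W) \<Lambda>))"
      by (metis rangeI)
    fix v assume "v \<in> range (\<lambda>\<Lambda>. convex_conjugate (sum_fun f) (- psd_sqrt (kron_id W) \<Lambda>))"
    then obtain Y where "v = convex_conjugate (sum_fun f) (- psd_sqrt (kron_id W) Y)" by auto
    then show "- sum_fun f Xs \<le> v"
      using fenchel_young[OF q \<mu>, of "- psd_sqrt (kron_id W) Y" Xs] by (simp add: sym)
  qed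
  moreover have "convex_conjugate (sum_fun f) 0 = - sum_fun f X0"
    using conjugate_at_gradient[OF q, of X0] X0 \<mu> by simp
  ultimately show ?thesis by (simp add: dual_gap_def)
qed

text \<open>At the minimizer the local gradients sum to 0, that is, their stack is orthogonal to every
  consensus vector, and these form the kernel of the Kronecker product.\<close>

lemma consensus_optimum_dual_certificate:
  fixes f :: "'n::finite \<Rightarrow> real^'d \<Rightarrow> real"
  assumes q: "\<And>i. quad_bounds \<mu> L (f i) (g i)" and L: "0 < L" and W: "mixing_matrix E W"
    and min: "is_arg_min (\<lambda>x. \<Sum>i\<in>UNIV. f i x) (\<lambda>x. True) xstar"
  shows "\<exists>Z. kron_id W Z = (\<chi> i. g i xstar)"
proof (rule selfadjoint_range)
  show "selfadjoint (kron_id W :: (real^'d)^'n \<Rightarrow> _)"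
    using psd_op_kron_id[OF W] by (rule psd_op_imp_selfadjoint)
  have "(\<Sum>i\<in>UNIV. g i xstar) = 0"
  proof (rule quad_bounds_gradient_zero_at_min[OF quad_bounds_sum[OF q]])
    show "0 < real CARD('n) * L" using L by simp
    show "(\<Sum>i\<in>UNIV. f i xstar) \<le> (\<Sum>i\<in>UNIV. f i y)" for y
      using min by (auto simp: is_arg_min_def not_less)
  qed
  fix Z :: "(real^'d)^'n" assume Z: "kron_id W Z = 0"
  \<comment> \<open>An arbitrary node, whose block represents the common value of all blocks.\<close>
  obtain j :: 'n where True by simp
  have "(\<chi> i. g i xstar) \<bullet> Z = (\<Sum>i\<in>UNIV. g i xstar \<bullet> Z $ j)"
    unfolding inner_vec_def[where 'b = 'n]
  proof (rule sum.cong)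
    fix i
    have "Z $ i = Z $ j" by (rule kron_id_kernel_consensus[OF W Z])
    then show "(\<chi> i. g i xstar) $ i \<bullet> Z $ i = g i xstar \<bullet> Z $ j" by simp
  qed simp
  also have "\<dots> = (\<Sum>i\<in>UNIV. g i xstar) \<bullet> Z $ j" by (rule inner_sum_left[symmetric])
  finally show "(\<chi> i. g i xstar) \<bullet> Z = 0" using \<open>(\<Sum>i\<in>UNIV. g i xstar) = 0\<close> by simp
qed

theorem theorem2:
  fixes E :: "('n::finite \<times> 'n) set"
    and W :: "real^'n^'n"
    and f :: "'n \<Rightarrow> real^'d \<Rightarrow> real"
    and xstar :: "real^'d"
    and \<mu> L \<rho> \<eta> L\<^sub>\<rho> \<mu>\<^sub>\<rho> C\<^sub>\<rho> :: real
    and \<beta> \<epsilon> :: "nat \<Rightarrow> real"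
    and \<Lambda> \<Omega> X :: "nat \<Rightarrow> (real^'d)^'n"
  assumes "0 < \<mu>" "\<mu> \<le> L"
    and "\<And>i. L_smooth L (f i)"
    and "\<And>i. strongly_convex \<mu> (f i)"
    and "is_arg_min (\<lambda>x. \<Sum>i\<in>UNIV. f i x) (\<lambda>x. True) xstar"
    and "mixing_matrix E W"
    and "0 \<le> \<rho>"
    and "L\<^sub>\<rho> = lambda_max W / (\<mu> + \<rho> * lambda_max W)"
    and "\<mu>\<^sub>\<rho> = lambda_min_pos W / (L + \<rho> * lambda_min_pos W)"
    and "C\<^sub>\<rho> = 258 * (L\<^sub>\<rho> * lambda_max W / (\<mu>\<^sup>2 * \<mu>\<^sub>\<rho>\<^sup>2))"
    and "\<And>k. \<beta> k = (sqrt L\<^sub>\<rho> - sqrt \<mu>\<^sub>\<rho>) / (sqrt L\<^sub>\<rho> + sqrt \<mu>\<^sub>\<rho>)"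
    and "\<eta> = 1 / L\<^sub>\<rho>"
    and "\<And>k. \<epsilon> k = \<mu>\<^sub>\<rho> / (2 * lambda_max W) * (1 - 1 / 2 * sqrt (\<mu>\<^sub>\<rho> / L\<^sub>\<rho>)) ^ k * dual_gap W f"
    and "IDEAL_iterates W f \<rho> \<eta> \<beta> \<epsilon> \<Lambda> \<Omega> X"
  shows "\<forall>k\<ge>1. (norm (X k - (\<chi> i. xstar)))\<^sup>2
           \<le> C\<^sub>\<rho> * (1 - 1 / 2 * sqrt (\<mu>\<^sub>\<rho> / L\<^sub>\<rho>)) ^ k * dual_gap W f"
proof (intro allI impI)
  fix k :: nat assume k: "1 \<le> k"
  have L: "0 < L" using assms(1,2) by simp
  have "\<forall>i. \<exists>h. quad_bounds \<mu> L (f i) h"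
    using quad_bounds_of_smooth_strongly_convex[OF assms(3,4)] by blast
  then obtain gi where gi: "\<And>i. quad_bounds \<mu> L (f i) (gi i)" by metis
  define F where "F = sum_fun f"
  define g where "g X = (\<chi> i. gi i (X $ i))" for X :: "(real^'d)^'n"
  define A where "A = (kron_id W :: (real^'d)^'n \<Rightarrow> (real^'d)^'n)"
  define S where "S = psd_sqrt A"
  define Xs where "Xs = (\<chi> i::'n. xstar)"
  have q: "quad_bounds \<mu> L F g" unfolding F_def g_def by (rule quad_bounds_sum_fun[OF gi])
  have A: "psd_op A" unfolding A_def by (rule psd_op_kron_id[OF assms(6)])
  have linA: "linear A" using A by (simp add: psd_op_def)
  have S: "psd_op S" "\<And>x. S (S x) = A x" unfolding S_def using psd_sqrt[OF A] by auto
  have linS: "linear S" using S by (simp add: psd_op_def)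
  have SA: "(norm (S x))\<^sup>2 = x \<bullet> A x" for x unfolding S_def by (rule psd_sqrt_inner[OF A])
  have top: "x \<bullet> A x \<le> lambda_max W * (norm x)\<^sup>2" for x
  proof (rule selfadjoint_quadratic_form_le[OF psd_op_imp_selfadjoint[OF A]])
    fix l assume "l \<in> op_eigenvalues A"
    then have "l \<in> eigenvalues W" using op_eigenvalues_kron_id unfolding A_def by blast
    then show "l \<le> lambda_max W"
      unfolding lambda_max_def by (intro Max_ge eigenvalues_mixing_matrix[OF assms(6)])
  qed
  obtain Z where Z: "A Z = g Xs"
    using consensus_optimum_dual_certificate[OF gi L assms(6,5)] unfolding A_def g_def Xs_def by auto
  define s where "s = - S Z"
  have s: "g Xs = - S s" "s \<in> range S"
    using Z linear_neg[OF linS] by (auto simp: s_def S(2) intro: image_eqI[of _ S "- Z"])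
  have AXs: "A Xs = 0" unfolding A_def Xs_def by (rule kron_id_consensus[OF assms(6)])
  then have SXs: "S Xs = 0" using SA[of Xs] by simp
  obtain X0 where X0: "g X0 = 0"
    using quad_bounds_critical_point_exists[OF q assms(1) L] by blast
  have gap_eq: "dual_gap W f = F Xs - F X0"
    unfolding F_def using assms(1) A X0 s(1) SXs q
    by (intro dual_gap_eq[of \<mu> L f g]) (simp_all add: A_def S_def F_def)
  have gap: "F Xs - F x \<le> dual_gap W f" for x
  proof -
    have "0 \<le> \<mu> / 2 * (norm (x - X0))\<^sup>2" using assms(1) by simp
    then show ?thesis using quad_bounds_growth[OF q X0, of x] gap_eq by linarith
  qed
  have sub: "subproblem W f \<rho> w = (\<lambda>x. F x + w \<bullet> x + \<rho> / 2 * (x \<bullet> A x))" for w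
    by (simp add: fun_eq_iff subproblem_def F_def A_def)
  have qsub: "quad_bounds \<mu> (L + \<rho> * lambda_max W) (subproblem W f \<rho> w) (\<lambda>x. g x + w + \<rho> *\<^sub>R A x)" for w
    unfolding sub by (rule quad_bounds_add_quadratic[OF q A top assms(7)])
  note it = assms(14)[unfolded IDEAL_iterates_def]
  show "(norm (X k - (\<chi> i. xstar)))\<^sup>2
           \<le> C\<^sub>\<rho> * (1 - 1 / 2 * sqrt (\<mu>\<^sub>\<rho> / L\<^sub>\<rho>)) ^ k * dual_gap W f"
  proof (cases "\<exists>l\<in>eigenvalues W. 0 < l")
    case False
    \<comment> \<open>A single node: the Kronecker product vanishes, so the dual variables stay 0; the accuracies are a division by 0, hence 0, and every primal iterate is the exact minimizer of F.\<close>
    then have e0: "eigenvalues W = {0}"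
      using eigenvalue_mixing_matrix_nonneg[OF assms(6)] eigenvalues_mixing_matrix(2)[OF assms(6)]
      by (force simp: order.order_iff_strict)
    then have lm: "lambda_max W = 0" by (simp add: lambda_max_def)
    have S0: "S x = 0" for x
    proof -
      have "(norm (S x))\<^sup>2 \<le> 0" using top[of x] SA[of x] lm by simp
      then show ?thesis by simp
    qed
    have A0: "A x = 0" for x using S(2)[of x] S0 by simp
    have "\<Lambda> k = 0 \<and> \<Omega> k = 0"
      using k
    proof (induction k rule: nat_induct_at_least)
      case base
      then show ?case using it by simp
    next
      case (Suc j)
      then have "\<Lambda> (j + 1) = 0" using it A0 by (simp add: A_def)
      moreover have "\<Omega> (j + 1) = \<Lambda> (j + 1) + \<beta> (j + 1) *\<^sub>R (\<Lambda> (j + 1) - \<Lambda> j)"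
        using it Suc.hyps by blast
      ultimately show ?case using Suc.IH by simp
    qed
    then have "g Xs + \<Omega> k + \<rho> *\<^sub>R A Xs = 0" by (simp add: s(1) S0 A0)
    then have "(ARG_MIN (subproblem W f \<rho> (\<Omega> k)) Y. True) = Xs"
      by (rule quad_bounds_ARG_MIN[OF qsub assms(1)])
    then have "(norm (X k - Xs))\<^sup>2 \<le> \<epsilon> k" using it k by metis
    then have "(norm (X k - Xs))\<^sup>2 \<le> 0" by (simp add: assms(13) lm)
    moreover have "C\<^sub>\<rho> = 0" by (simp add: assms(10) lm)
    ultimately show ?thesis by (simp add: Xs_def)
  next
    case True
    define lmin where "lmin = lambda_min_pos W"
    define lmax where "lmax = lambda_max W"
    have finE: "finite {l \<in> eigenvalues W. 0 < l}" using eigenvalues_mixing_matrix(1)[OF assms(6)] by simp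
    have "lmin \<in> {l \<in> eigenvalues W. 0 < l}"
      unfolding lmin_def lambda_min_pos_def using True finE by (intro Min_in) auto
    then have lmin: "lmin \<in> eigenvalues W" "0 < lmin" by auto
    have lle: "lmin \<le> lmax"
      unfolding lmax_def lambda_max_def by (intro Max_ge eigenvalues_mixing_matrix[OF assms(6)] lmin)
    have Lsub: "0 < L + \<rho> * lambda_max W"
      using L lle lmin assms(7) by (simp add: lmax_def add_pos_nonneg)
    have "\<forall>a. \<exists>x. g x + S a + \<rho> *\<^sub>R A x = 0"
      using quad_bounds_critical_point_exists[OF qsub assms(1) Lsub] by blast
    then obtain M where M: "\<And>a. g (M a) + S a + \<rho> *\<^sub>R A (M a) = 0" by metis
    interpret D: augmented_dual F g S M \<mu> L \<rho> lmin lmax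
    proof
      show "quad_bounds \<mu> L F g" by (rule q)
      show "psd_op S" by (rule S)
      show "(norm (S x))\<^sup>2 \<le> lmax * (norm x)\<^sup>2" for x using top[of x] SA[of x] by (simp add: lmax_def)
      show "\<exists>z. S z = S x \<and> lmin * (norm z)\<^sup>2 \<le> (norm (S z))\<^sup>2" for x
      proof -
        have "lmin \<le> l" if "l \<in> op_eigenvalues A" "0 < l" for l
          unfolding lmin_def lambda_min_pos_def
          using that op_eigenvalues_kron_id[of W] finE by (intro Min_le) (auto simp: A_def)
        from psd_op_spectral_gap[OF A this] obtain z where
          z: "A z = A x" "lmin * (norm z)\<^sup>2 \<le> z \<bullet> A z" by blast
        have "(norm (S (z - x)))\<^sup>2 = 0" unfolding SA by (simp add: linear_diff[OF linA] z(1))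
        then have "S z = S x" by (simp add: linear_diff[OF linS])
        then show ?thesis using z(2) SA by auto
      qed
      show "g (M a) + \<rho> *\<^sub>R S (S (M a)) + S a = 0" for a
        using M[of a] by (simp add: S(2) algebra_simps)
    qed (use assms(1,2,7) lmin lle in auto)
    have par: "L\<^sub>\<rho> = D.L\<^sub>\<rho>" "\<mu>\<^sub>\<rho> = D.\<mu>\<^sub>\<rho>"
      unfolding D.L\<^sub>\<rho>_def D.\<mu>\<^sub>\<rho>_def by (simp_all add: assms(8,9) lmin_def lmax_def)
    define b where "b = (sqrt L\<^sub>\<rho> - sqrt \<mu>\<^sub>\<rho>) / (sqrt L\<^sub>\<rho> + sqrt \<mu>\<^sub>\<rho>)"
    define r where "r = 1 - 1 / 2 * sqrt (\<mu>\<^sub>\<rho> / L\<^sub>\<rho>)"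
    \<comment> \<open>The dual iterates before multiplication by S; the sequences start at index 1, the recursion at 0.\<close>
    define uy where "uy = rec_nat (0, 0) (\<lambda>n (u, y).
      let u' = y + (1 / L\<^sub>\<rho>) *\<^sub>R S (X (Suc n)) in (u', u' + b *\<^sub>R (u' - u)))"
    define u where "u j = fst (uy (j - 1))" for j
    define y where "y j = snd (uy (j - 1))" for j
    have init: "u 1 = 0" "y 1 = 0" by (simp_all add: u_def y_def uy_def)
    have us: "u (j + 1) = y j + (1 / L\<^sub>\<rho>) *\<^sub>R S (X j)"
      and ys: "y (j + 1) = u (j + 1) + b *\<^sub>R (u (j + 1) - u j)" if "1 \<le> j" for j
    proof -
      obtain n where "j = Suc n" using \<open>1 \<le> j\<close> by (cases j) auto
      then show "u (j + 1) = y j + (1 / L\<^sub>\<rho>) *\<^sub>R S (X j)"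
        "y (j + 1) = u (j + 1) + b *\<^sub>R (u (j + 1) - u j)"
        by (simp_all add: u_def y_def uy_def Let_def split_beta)
    qed
    have lift: "S (u j) = \<Lambda> j \<and> S (y j) = \<Omega> j" if "1 \<le> j" for j
      using that
    proof (induction j rule: nat_induct_at_least)
      case base
      then show ?case using it init linear_0[OF linS] by simp
    next
      case (Suc j)
      have "\<Lambda> (j + 1) = \<Omega> j + \<eta> *\<^sub>R A (X j)"
        "\<Omega> (j + 1) = \<Lambda> (j + 1) + b *\<^sub>R (\<Lambda> (j + 1) - \<Lambda> j)"
        using it Suc.hyps assms(11) unfolding A_def b_def by metis+
      then have "S (u (j + 1)) = \<Lambda> (j + 1) \<and> S (y (j + 1)) = \<Omega> (j + 1)"
        using Suc.IH unfolding ys[OF Suc.hyps] us[OF Suc.hyps]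
        by (simp add: linear_add[OF linS] linear_diff[OF linS] linear_scale[OF linS] S(2) assms(12))
      then show ?case by simp
    qed
    have "(norm (X k - Xs))\<^sup>2 \<le> 17 * (D.L\<^sub>\<rho> * lmax / (\<mu>\<^sup>2 * D.\<mu>\<^sub>\<rho>\<^sup>2)) * r ^ k * dual_gap W f"
    proof (rule D.convergence[where u = u and y = y and s = s])
      show "(norm (X j - M (y j)))\<^sup>2 \<le> D.\<mu>\<^sub>\<rho> / (2 * lmax) * r ^ j * dual_gap W f" if "1 \<le> j" for j
      proof -
        have "g (M (y j)) + \<Omega> j + \<rho> *\<^sub>R A (M (y j)) = 0" using M[of "y j"] lift[OF that] by simp
        then have "(ARG_MIN (subproblem W f \<rho> (\<Omega> j)) Y. True) = M (y j)"
          by (rule quad_bounds_ARG_MIN[OF qsub assms(1)])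
        then have "(norm (X j - M (y j)))\<^sup>2 \<le> \<epsilon> j" using it that by metis
        then show ?thesis by (simp add: assms(13) par lmax_def r_def)
      qed
    qed (use SXs s init us ys gap k in \<open>auto simp: par r_def b_def\<close>)
    then have bound: "(norm (X k - Xs))\<^sup>2
      \<le> 17 * (L\<^sub>\<rho> * lambda_max W / (\<mu>\<^sup>2 * \<mu>\<^sub>\<rho>\<^sup>2) * r ^ k * dual_gap W f)"
      by (simp add: par lmax_def)
    note bound
    also have "17 * (L\<^sub>\<rho> * lambda_max W / (\<mu>\<^sup>2 * \<mu>\<^sub>\<rho>\<^sup>2) * r ^ k * dual_gap W f) \<le> 258 * (L\<^sub>\<rho> * lambda_max W / (\<mu>\<^sup>2 * \<mu>\<^sub>\<rho>\<^sup>2) * r ^ k * dual_gap W f)"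
      using order_trans[OF zero_le_power2 bound] by linarith
    finally show ?thesis by (simp add: assms(10) r_def Xs_def mult.assoc)
  qed
qed

end
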